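(* Up to inner automorphism, the $4$-dimensional solvable subalgebras of $A_2$ are classified by the following list, where in the parametrized family $\alpha\in\mathbb{C}$, $\alpha\neq\pm1$: $$\begin{array}{lll} M_8^1 &=& \langle x_1, x_3, h_1, h_2\rangle,\\ M_8^2 &=& \langle x_1, y_2, h_1, h_2\rangle,\\ M_{12}^1 &=& \langle x_1, x_2, x_3, h_1+h_2\rangle,\\ M^{1,\alpha}_{13,\frac{(2\alpha-1)(\alpha-2)}{(\alpha+1)^2}} &=& \langle x_1, x_2, x_3, \alpha h_1+h_2\rangle,\\ M^2_{13,2} &=& \langle x_1, x_2, x_3, h_1\rangle,\\ M_{14}^1 &=& \langle x_1, x_2, x_3, h_1-h_2\rangle. \end{array}$$ The subscript of each listed subalgebra gives its isomorphism type among the Lie algebras $M_8$, $M_{12}$, $M_{13,a}$, $M_{14}$. Every $4$-dimensional solvable subalgebra of $A_2$ is equivalent to one on the list, and the listed subalgebras are pairwise inequivalent; in particular, for $\alpha,\beta\in\mathbb{C}\setminus\{1,-1\}$, $M^{1,\alpha}_{13,\frac{(2\alpha-1)(\alpha-2)}{(\alpha+1)^2}}$ and $M^{1,\beta}_{13,\frac{(2\beta-1)(\beta-2)}{(\beta+1)^2}}$ are equivalent if and only if $\alpha=\beta$.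
   Context: $A_2$ is the Lie algebra of traceless $3\times3$ complex matrices. Its Chevalley basis $x_i,y_i$ ($1\le i\le 3$), $h_1,h_2$ is defined by $$ah_1+bh_2+cx_1+dx_2+ex_3+c'y_1+d'y_2+e'y_3=\begin{pmatrix} a & c & -e\\ c' & b-a & d\\ -e' & d' & -b\end{pmatrix}.$$ $\langle W_1,\dots,W_m\rangle$ denotes the Lie subalgebra of $A_2$ generated by $W_1,\dots,W_m$. Two subalgebras are equivalent if an inner automorphism of $A_2$ maps one onto the other, i.e. if they are conjugate by an element of $\mathrm{SL}(3,\mathbb{C})$. The following are complex Lie algebras with basis $z_1,z_2,z_3,z_4$ and the indicated nonzero brackets (up to antisymmetry): $M_8$: $[z_1,z_2]=z_2$, $[z_3,z_4]=z_4$; $M_{12}$: $[z_4,z_1]=z_1$, $[z_4,z_2]=2z_2$, $[z_4,z_3]=z_3$, $[z_3,z_1]=z_2$; $M_{13,a}$ ($a\in\mathbb{C}$): $[z_4,z_1]=z_1+az_3$, $[z_4,z_2]=z_2$, $[z_4,z_3]=z_1$, $[z_3,z_1]=z_2$; $M_{14}$: $[z_4,z_1]=z_3$, $[z_4,z_3]=z_1$, $[z_3,z_1]=z_2$. *)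

theory Defs
  imports "HOL-Analysis.Analysis"
begin

section \<open>Complex Lie algebras\<close>

locale complex_lie_algebra = vector_space scale
  for scale :: "complex \<Rightarrow> 'a::ab_group_add \<Rightarrow> 'a" (infixr \<open>*\<^sub>L\<close> 75) +
  fixes bracket :: "'a \<Rightarrow> 'a \<Rightarrow> 'a"
  assumes bracket_add_left: "bracket (x + y) z = bracket x z + bracket y z"
    and bracket_add_right: "bracket x (y + z) = bracket x y + bracket x z"
    and bracket_scale_left: "bracket (c *\<^sub>L x) y = c *\<^sub>L bracket x y"
    and bracket_scale_right: "bracket x (c *\<^sub>L y) = c *\<^sub>L bracket x y"
    and bracket_self: "bracket x x = 0"
    and jacobi: "bracket x (bracket y z) + bracket y (bracket z x) + bracket z (bracket x y) = 0"
begin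

definition lie_subalgebra :: "'a set \<Rightarrow> bool" where
  "lie_subalgebra S \<longleftrightarrow> subspace S \<and> (\<forall>x\<in>S. \<forall>y\<in>S. bracket x y \<in> S)"

definition derived :: "'a set \<Rightarrow> 'a set" where
  "derived S = span {bracket x y | x y. x \<in> S \<and> y \<in> S}"

definition solvable :: "'a set \<Rightarrow> bool" where
  "solvable S \<longleftrightarrow> (\<exists>n. (derived ^^ n) S = {0})"

end


section \<open>Matrices and the Lie algebra \<open>A\<^sub>2\<close>\<close>

text \<open>On matrices, \<open>(*s)\<close> is not multiplication by a complex scalar (it expects a row vector
  as its first argument), so the entrywise scaling is introduced here.\<close>

definition mscale :: "complex \<Rightarrow> complex^'n^'m \<Rightarrow> complex^'n^'m" where
  "mscale c A = (\<chi> i j. c * A $ i $ j)"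

definition commutator :: "complex^'n^'n \<Rightarrow> complex^'n^'n \<Rightarrow> complex^'n^'n" where
  "commutator A B = A ** B - B ** A"

lemma mscale_mult_left: "mscale c A ** B = mscale c (A ** B)"
  by (simp add: mscale_def matrix_matrix_mult_def vec_eq_iff sum_distrib_left mult.assoc)

lemma mscale_mult_right: "A ** mscale c B = mscale c (A ** B)"
  by (simp add: mscale_def matrix_matrix_mult_def vec_eq_iff sum_distrib_left mult.left_commute)

lemma matrix_add_rdistrib': "(B + C) ** A = B ** A + C ** (A :: complex^'n^'n)"
  by (simp add: matrix_matrix_mult_def vec_eq_iff sum.distrib distrib_right)

lemma matrix_sub_ldistrib: "A ** (B - C) = A ** B - A ** (C :: complex^'n^'n)"
  by (simp add: matrix_matrix_mult_def vec_eq_iff sum_subtractf right_diff_distrib)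

lemma matrix_sub_rdistrib: "(B - C) ** A = B ** A - C ** (A :: complex^'n^'n)"
  by (simp add: matrix_matrix_mult_def vec_eq_iff sum_subtractf left_diff_distrib)

global_interpretation gl: complex_lie_algebra
  "mscale :: complex \<Rightarrow> complex^'n^'n \<Rightarrow> complex^'n^'n" commutator
proof unfold_locales
  fix a b :: complex and x y z :: "complex^'n^'n"
  show "mscale a (x + y) = mscale a x + mscale a y" "mscale (a + b) x = mscale a x + mscale b x"
    "mscale a (mscale b x) = mscale (a * b) x" "mscale 1 x = x"
    by (simp_all add: mscale_def vec_eq_iff algebra_simps)
  have diff: "mscale a (x - y) = mscale a x - mscale a y" for x y :: "complex^'n^'n"
    by (simp add: mscale_def vec_eq_iff algebra_simps)
  show "commutator (x + y) z = commutator x z + commutator y z"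
    "commutator x (y + z) = commutator x y + commutator x z"
    by (simp_all add: commutator_def matrix_add_ldistrib matrix_add_rdistrib')
  show "commutator (mscale a x) y = mscale a (commutator x y)"
    "commutator x (mscale a y) = mscale a (commutator x y)"
    by (simp_all add: commutator_def mscale_mult_left mscale_mult_right diff)
  show "commutator x x = 0"
    by (simp add: commutator_def)
  show "commutator x (commutator y z) + commutator y (commutator z x) +
    commutator z (commutator x y) = 0"
    by (simp add: commutator_def matrix_sub_ldistrib matrix_sub_rdistrib matrix_mul_assoc)
qed

definition A2 :: "(complex^3^3) set" where
  "A2 = {A. trace A = 0}"

definition A2_subalgebra :: "(complex^3^3) set \<Rightarrow> bool" where
  "A2_subalgebra L \<longleftrightarrow> gl.lie_subalgebra L \<and> L \<subseteq> A2"

lemma A2_subalgebra_A2: "A2_subalgebra A2"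
proof -
  have "trace (mscale c A) = c * trace A" for c and A :: "complex^3^3"
    by (simp add: trace_def mscale_def sum_distrib_left)
  moreover have "trace (commutator A B) = 0" for A B :: "complex^3^3"
    using trace_mul_sym[of A B] by (simp add: commutator_def trace_sub)
  ultimately show ?thesis
    by (simp add: A2_subalgebra_def A2_def gl.lie_subalgebra_def gl.subspace_def
        trace_add) (simp add: trace_def)
qed

definition generated :: "(complex^3^3) set \<Rightarrow> (complex^3^3) set" where
  "generated X = A2_subalgebra hull X"

definition equivalent :: "(complex^3^3) set \<Rightarrow> (complex^3^3) set \<Rightarrow> bool" where
  "equivalent L L' \<longleftrightarrow>
     (\<exists>g :: complex^3^3. det g = 1 \<and> (\<lambda>A. g ** A ** matrix_inv g) ` L = L')"


subsection \<open>The Chevalley basis\<close>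

text \<open>\<open>chevalley a b c d e c' d' e'\<close> is
  \<open>a h\<^sub>1 + b h\<^sub>2 + c x\<^sub>1 + d x\<^sub>2 + e x\<^sub>3 + c' y\<^sub>1 + d' y\<^sub>2 + e' y\<^sub>3\<close>.\<close>

definition chevalley ::
  "complex \<Rightarrow> complex \<Rightarrow> complex \<Rightarrow> complex \<Rightarrow> complex \<Rightarrow> complex \<Rightarrow> complex \<Rightarrow> complex
     \<Rightarrow> complex^3^3" where
  "chevalley a b c d e c' d' e' =
     vector [vector [  a,    c,     -e],
             vector [  c',   b - a,  d],
             vector [ -e',   d',    -b]]"

definition h1 :: "complex^3^3" where "h1 = chevalley 1 0 0 0 0 0 0 0"
definition h2 :: "complex^3^3" where "h2 = chevalley 0 1 0 0 0 0 0 0"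
definition x1 :: "complex^3^3" where "x1 = chevalley 0 0 1 0 0 0 0 0"
definition x2 :: "complex^3^3" where "x2 = chevalley 0 0 0 1 0 0 0 0"
definition x3 :: "complex^3^3" where "x3 = chevalley 0 0 0 0 1 0 0 0"
definition y1 :: "complex^3^3" where "y1 = chevalley 0 0 0 0 0 1 0 0"
definition y2 :: "complex^3^3" where "y2 = chevalley 0 0 0 0 0 0 1 0"
definition y3 :: "complex^3^3" where "y3 = chevalley 0 0 0 0 0 0 0 1"

lemma chevalley_expand:
  "chevalley a b c d e c' d' e' =
     mscale a h1 + mscale b h2 + mscale c x1 + mscale d x2 + mscale e x3 +
     mscale c' y1 + mscale d' y2 + mscale e' y3"
  by (simp add: h1_def h2_def x1_def x2_def x3_def y1_def y2_def y3_def chevalley_def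
      mscale_def vec_eq_iff forall_3)


section \<open>The abstract four-dimensional Lie algebras\<close>

text \<open>The Lie algebras \<open>M\<close> are realised on \<open>complex^4\<close> with \<open>z\<^sub>i = zb i\<close> the standard basis. Since
  \<open>pair i j z\<^sub>i z\<^sub>j = 1\<close>, \<open>pair i j z\<^sub>j z\<^sub>i = -1\<close>, and \<open>pair i j\<close> is bilinear and vanishes on all
  other pairs of basis vectors, a bracket relation \<open>[z\<^sub>i, z\<^sub>j] = w\<close> contributes the summand
  \<open>pair i j u v *s w\<close>.\<close>

definition zb :: "4 \<Rightarrow> complex^4" where
  "zb i = axis i 1"

definition pair :: "4 \<Rightarrow> 4 \<Rightarrow> complex^4 \<Rightarrow> complex^4 \<Rightarrow> complex" where
  "pair i j u v = u $ i * v $ j - u $ j * v $ i"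

definition M8 :: "complex^4 \<Rightarrow> complex^4 \<Rightarrow> complex^4" where
  "M8 u v = pair 1 2 u v *s zb 2 + pair 3 4 u v *s zb 4"

definition M12 :: "complex^4 \<Rightarrow> complex^4 \<Rightarrow> complex^4" where
  "M12 u v = pair 4 1 u v *s zb 1 + pair 4 2 u v *s (2 *s zb 2) + pair 4 3 u v *s zb 3
     + pair 3 1 u v *s zb 2"

definition M13 :: "complex \<Rightarrow> complex^4 \<Rightarrow> complex^4 \<Rightarrow> complex^4" where
  "M13 a u v = pair 4 1 u v *s (zb 1 + a *s zb 3) + pair 4 2 u v *s zb 2 + pair 4 3 u v *s zb 1
     + pair 3 1 u v *s zb 2"

definition M14 :: "complex^4 \<Rightarrow> complex^4 \<Rightarrow> complex^4" where
  "M14 u v = pair 4 1 u v *s zb 3 + pair 4 3 u v *s zb 1 + pair 3 1 u v *s zb 2"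

lemma complex_lie_algebra_M:
  "complex_lie_algebra (*s) M8" "complex_lie_algebra (*s) M12"
  "complex_lie_algebra (*s) (M13 a)" "complex_lie_algebra (*s) M14"
  by (unfold_locales;
      simp add: M8_def M12_def M13_def M14_def pair_def zb_def axis_def vec_eq_iff forall_4
        algebra_simps)+

definition isomorphic_to :: "(complex^3^3) set \<Rightarrow> (complex^4 \<Rightarrow> complex^4 \<Rightarrow> complex^4) \<Rightarrow> bool"
  where
  "isomorphic_to L M \<longleftrightarrow>
     (\<exists>f. Vector_Spaces.linear (*s) mscale f \<and> bij_betw f UNIV L \<and>
          (\<forall>u v. f (M u v) = commutator (f u) (f v)))"


section \<open>The list of subalgebras\<close>

datatype label = L8_1 | L8_2 | L12_1 | L13_1 complex | L13_2 | L14_1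

definition labels :: "label set" where
  "labels = {L8_1, L8_2, L12_1, L13_2, L14_1} \<union> L13_1 ` {\<alpha>. \<alpha> \<noteq> 1 \<and> \<alpha> \<noteq> -1}"

fun subalg :: "label \<Rightarrow> (complex^3^3) set" where
  "subalg L8_1 = generated {x1, x3, h1, h2}"
| "subalg L8_2 = generated {x1, y2, h1, h2}"
| "subalg L12_1 = generated {x1, x2, x3, h1 + h2}"
| "subalg (L13_1 \<alpha>) = generated {x1, x2, x3, mscale \<alpha> h1 + h2}"
| "subalg L13_2 = generated {x1, x2, x3, h1}"
| "subalg L14_1 = generated {x1, x2, x3, h1 - h2}"

end

theory Submission
  imports Defs "HOL-Computational_Algebra.Fundamental_Theorem_Algebra"
begin

text \<open>By Lie's theorem, applied to a solvable subalgebra \<open>L\<close> and to its transpose, \<open>L\<close> preserves a flag of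
  a line inside a plane, so it is conjugate to a subalgebra of the five-dimensional Borel algebra of
  traceless upper triangular matrices. There a four-dimensional \<open>L\<close> is the kernel of a linear
  functional, which vanishes on \<open>x\<^sub>3\<close> and on at least one of \<open>x\<^sub>1\<close>, \<open>x\<^sub>2\<close> because \<open>L\<close> is closed under
  brackets. If it vanishes on both, \<open>L\<close> is the nilradical plus one toral line; otherwise the
  condition on the torus lets a unipotent conjugation bring \<open>L\<close> to one of the two forms of
  type \<open>M\<^sub>8\<close>.

  For inequivalence, the nilradical forms contain a nilpotent matrix with nonzero square, the others
  do not. A conjugation between two nilradical forms preserves the set of strictly upper triangular
  matrices, hence is upper triangular and fixes the diagonal part of every element.\<close>

section \<open>Explicit descriptions of the listed subalgebras\<close>

lemma chevalley_entries [simp]: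
  "chevalley a b c d e c' d' e' $ 1 $ 1 = a"
  "chevalley a b c d e c' d' e' $ 1 $ 2 = c"
  "chevalley a b c d e c' d' e' $ 1 $ 3 = - e"
  "chevalley a b c d e c' d' e' $ 2 $ 1 = c'"
  "chevalley a b c d e c' d' e' $ 2 $ 2 = b - a"
  "chevalley a b c d e c' d' e' $ 2 $ 3 = d"
  "chevalley a b c d e c' d' e' $ 3 $ 1 = - e'"
  "chevalley a b c d e c' d' e' $ 3 $ 2 = d'"
  "chevalley a b c d e c' d' e' $ 3 $ 3 = - b"
  by (simp_all add: chevalley_def)

lemma matrix_mult_entry_3:
  fixes A B :: "complex^3^3"
  shows "(A ** B) $ i $ j = A $ i $ 1 * B $ 1 $ j + A $ i $ 2 * B $ 2 $ j + A $ i $ 3 * B $ 3 $ j"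
  by (simp add: matrix_matrix_mult_def sum_3)

lemma matrix_eq_iff_3:
  fixes A B :: "complex^3^3"
  shows "A = B \<longleftrightarrow>
    A $ 1 $ 1 = B $ 1 $ 1 \<and> A $ 1 $ 2 = B $ 1 $ 2 \<and> A $ 1 $ 3 = B $ 1 $ 3 \<and>
    A $ 2 $ 1 = B $ 2 $ 1 \<and> A $ 2 $ 2 = B $ 2 $ 2 \<and> A $ 2 $ 3 = B $ 2 $ 3 \<and>
    A $ 3 $ 1 = B $ 3 $ 1 \<and> A $ 3 $ 2 = B $ 3 $ 2 \<and> A $ 3 $ 3 = B $ 3 $ 3"
  by (simp add: vec_eq_iff forall_3)

lemma chevalley_add:
  "chevalley a b c d e f g h + chevalley a' b' c' d' e' f' g' h' =
   chevalley (a + a') (b + b') (c + c') (d + d') (e + e') (f + f') (g + g') (h + h')"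
  by (simp add: matrix_eq_iff_3)

lemma chevalley_diff:
  "chevalley a b c d e f g h - chevalley a' b' c' d' e' f' g' h' =
   chevalley (a - a') (b - b') (c - c') (d - d') (e - e') (f - f') (g - g') (h - h')"
  by (simp add: matrix_eq_iff_3)

lemma chevalley_scale:
  "mscale k (chevalley a b c d e f g h) =
   chevalley (k * a) (k * b) (k * c) (k * d) (k * e) (k * f) (k * g) (k * h)"
  by (simp add: matrix_eq_iff_3 mscale_def algebra_simps)

lemma chevalley_zero: "chevalley 0 0 0 0 0 0 0 0 = 0"
  by (simp add: matrix_eq_iff_3)

lemma chevalley_eq_iff:
  "chevalley a b c d e f g h = chevalley a' b' c' d' e' f' g' h' \<longleftrightarrow>
   a = a' \<and> b = b' \<and> c = c' \<and> d = d' \<and> e = e' \<and> f = f' \<and> g = g' \<and> h = h'"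
  by (auto simp: matrix_eq_iff_3)

lemma chevalley_commutator:
  "commutator (chevalley a b c d e f g h) (chevalley a' b' c' d' e' f' g' h') =
   chevalley
     (c * f' - f * c' + e * h' - h * e')
     (d * g' - g * d' + e * h' - h * e')
     ((2 * a - b) * c' - (2 * a' - b') * c - e * g' + g * e')
     ((2 * b - a) * d' - (2 * b' - a') * d - f * e' + e * f')
     ((a + b) * e' - (a' + b') * e - c * d' + d * c')
     ((2 * a' - b') * f - (2 * a - b) * f' + h * d' - d * h')
     ((2 * b' - a') * g - (2 * b - a) * g' + c * h' - h * c')
     ((a' + b') * h - (a + b) * h' + f * g' - g * f')"
  by (simp add: matrix_eq_iff_3 commutator_def matrix_mult_entry_3; algebra)

lemma A2_eq_range:
  "A2 = {chevalley a b c d e c' d' e' | a b c d e c' d' e'. True}"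
proof -
  have "\<exists>a b c d e c' d' e'. A = chevalley a b c d e c' d' e'" if "A \<in> A2" for A
  proof -
    have "A = chevalley (A $ 1 $ 1) (- A $ 3 $ 3) (A $ 1 $ 2) (A $ 2 $ 3) (- A $ 1 $ 3)
        (A $ 2 $ 1) (A $ 3 $ 2) (- A $ 3 $ 1)"
      using that by (simp add: matrix_eq_iff_3 A2_def trace_def sum_3) algebra
    then show ?thesis by blast
  qed
  moreover have "chevalley a b c d e c' d' e' \<in> A2" for a b c d e c' d' e'
    by (simp add: A2_def trace_def sum_3)
  ultimately show ?thesis by blast
qed

definition alg8_1 :: "(complex^3^3) set" where
  "alg8_1 = {chevalley a b c 0 e 0 0 0 | a b c e. True}"
definition alg8_2 :: "(complex^3^3) set" where
  "alg8_2 = {chevalley a b c 0 0 0 d 0 | a b c d. True}"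
text \<open>The pair \<open>p\<close>, \<open>q\<close> serves as homogeneous coordinates of a toral
  line, so that the types \<open>M12\<close>, \<open>M13\<close> and \<open>M14\<close> belong to a
  single family, the point at infinity \<open>q = 0\<close> included.\<close>

definition toral_nil :: "complex \<Rightarrow> complex \<Rightarrow> (complex^3^3) set" where
  "toral_nil p q = {chevalley (s * p) (s * q) c d e 0 0 0 | s c d e. True}"

lemma A2_subalgebraI:
  assumes "L \<subseteq> A2" "0 \<in> L" "\<And>A B. A \<in> L \<Longrightarrow> B \<in> L \<Longrightarrow> A + B \<in> L"
    "\<And>k A. A \<in> L \<Longrightarrow> mscale k A \<in> L" "\<And>A B. A \<in> L \<Longrightarrow> B \<in> L \<Longrightarrow> commutator A B \<in> L"
  shows "A2_subalgebra L"
  using assms by (simp add: A2_subalgebra_def gl.lie_subalgebra_def gl.subspace_def)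

lemma A2_subalgebra_alg8_1: "A2_subalgebra alg8_1"
proof (rule A2_subalgebraI)
  show "alg8_1 \<subseteq> A2" unfolding alg8_1_def A2_eq_range by blast
  show "0 \<in> alg8_1" unfolding alg8_1_def chevalley_zero[symmetric] by blast
qed (auto simp: alg8_1_def chevalley_add chevalley_scale chevalley_commutator chevalley_eq_iff)

lemma A2_subalgebra_alg8_2: "A2_subalgebra alg8_2"
proof (rule A2_subalgebraI)
  show "alg8_2 \<subseteq> A2" unfolding alg8_2_def A2_eq_range by blast
  show "0 \<in> alg8_2" unfolding alg8_2_def chevalley_zero[symmetric] by blast
qed (auto simp: alg8_2_def chevalley_add chevalley_scale chevalley_commutator chevalley_eq_iff)

lemma toral_nil_member: "chevalley (s * p) (s * q) c d e 0 0 0 \<in> toral_nil p q"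
  unfolding toral_nil_def by blast

lemma A2_subalgebra_toral_nil: "A2_subalgebra (toral_nil p q)"
proof (rule A2_subalgebraI)
  show "toral_nil p q \<subseteq> A2" unfolding toral_nil_def A2_eq_range by blast
  show "0 \<in> toral_nil p q" using toral_nil_member[of 0 p q 0 0 0] by (simp add: chevalley_zero)
  fix A B k assume A: "A \<in> toral_nil p q"
  then obtain s c d e where Ae: "A = chevalley (s * p) (s * q) c d e 0 0 0" unfolding toral_nil_def by blast
  show "mscale k A \<in> toral_nil p q" using toral_nil_member[of "k * s" p q]
    by (simp add: Ae chevalley_scale mult.assoc)
  assume "B \<in> toral_nil p q"
  then obtain s' c' d' e' where Be: "B = chevalley (s' * p) (s' * q) c' d' e' 0 0 0" unfolding toral_nil_def by blast
  show "A + B \<in> toral_nil p q" using toral_nil_member[of "s + s'" p q]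
    by (simp add: Ae Be chevalley_add distrib_right)
  show "commutator A B \<in> toral_nil p q" using toral_nil_member[of 0 p q]
    by (simp add: Ae Be chevalley_commutator)
qed

lemma generated_eqI:
  assumes "A2_subalgebra S" "X \<subseteq> S" "\<And>L. A2_subalgebra L \<Longrightarrow> X \<subseteq> L \<Longrightarrow> S \<subseteq> L"
  shows "generated X = S"
  unfolding generated_def using assms by (intro hull_unique) auto

lemma A2_subalgebraD:
  assumes "A2_subalgebra L"
  shows "0 \<in> L" "\<And>A B. A \<in> L \<Longrightarrow> B \<in> L \<Longrightarrow> A + B \<in> L"
    "\<And>k A. A \<in> L \<Longrightarrow> mscale k A \<in> L" "\<And>A B. A \<in> L \<Longrightarrow> B \<in> L \<Longrightarrow> commutator A B \<in> L"
  using assms by (simp_all add: A2_subalgebra_def gl.lie_subalgebra_def gl.subspace_def)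

lemmas xyh_defs = h1_def h2_def x1_def x2_def x3_def y1_def y2_def y3_def

lemma subalg_L8_1: "subalg L8_1 = alg8_1"
  unfolding subalg.simps
proof (rule generated_eqI[OF A2_subalgebra_alg8_1])
  show "{x1, x3, h1, h2} \<subseteq> alg8_1" unfolding alg8_1_def xyh_defs by blast
  fix L assume L: "A2_subalgebra L" "{x1, x3, h1, h2} \<subseteq> L"
  have "chevalley a b c 0 e 0 0 0 = mscale a h1 + mscale b h2 + mscale c x1 + mscale e x3" for a b c e
    by (simp add: xyh_defs chevalley_scale chevalley_add)
  with L show "alg8_1 \<subseteq> L" by (auto simp: alg8_1_def intro!: A2_subalgebraD(2,3))
qed

lemma subalg_L8_2: "subalg L8_2 = alg8_2"
  unfolding subalg.simps
proof (rule generated_eqI[OF A2_subalgebra_alg8_2])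
  show "{x1, y2, h1, h2} \<subseteq> alg8_2" unfolding alg8_2_def xyh_defs by blast
  fix L assume L: "A2_subalgebra L" "{x1, y2, h1, h2} \<subseteq> L"
  have "chevalley a b c 0 0 0 d 0 = mscale a h1 + mscale b h2 + mscale c x1 + mscale d y2" for a b c d
    by (simp add: xyh_defs chevalley_scale chevalley_add)
  with L show "alg8_2 \<subseteq> L" by (auto simp: alg8_2_def intro!: A2_subalgebraD(2,3))
qed

lemma generated_toral_nil: "generated {x1, x2, x3, mscale p h1 + mscale q h2} = toral_nil p q"
proof (rule generated_eqI[OF A2_subalgebra_toral_nil])
  show "{x1, x2, x3, mscale p h1 + mscale q h2} \<subseteq> toral_nil p q"
    using toral_nil_member[of 0 p q] toral_nil_member[of 1 p q]
    by (simp add: xyh_defs chevalley_scale chevalley_add)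
  fix L assume L: "A2_subalgebra L" "{x1, x2, x3, mscale p h1 + mscale q h2} \<subseteq> L"
  have "chevalley (s * p) (s * q) c d e 0 0 0 =
     mscale s (mscale p h1 + mscale q h2) + mscale c x1 + mscale d x2 + mscale e x3" for s c d e
    by (simp add: xyh_defs chevalley_scale chevalley_add)
  with L show "toral_nil p q \<subseteq> L" by (auto simp: toral_nil_def intro!: A2_subalgebraD(2,3))
qed

lemma subalg_L12: "subalg L12_1 = toral_nil 1 1"
  using generated_toral_nil[of 1 1] by simp

lemma subalg_L13: "subalg (L13_1 \<alpha>) = toral_nil \<alpha> 1"
  using generated_toral_nil[of \<alpha> 1] by simp

lemma subalg_L13_2: "subalg L13_2 = toral_nil 1 0"
  using generated_toral_nil[of 1 0] by simp

lemma subalg_L14: "subalg L14_1 = toral_nil 1 (-1)"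
  using generated_toral_nil[of 1 "-1"] gl.scale_minus_left[of 1 h2] by simp

section \<open>Isomorphism types of the listed subalgebras\<close>

lemma isomorphic_toI:
  fixes f :: "complex^4 \<Rightarrow> complex^3^3"
  assumes "\<And>u v. f (u + v) = f u + f v" "\<And>c u. f (c *s u) = mscale c (f u)"
    and "\<And>u v. f (M u v) = commutator (f u) (f v)"
    and "\<And>u. f u \<in> L" "\<And>u. g (f u) = u" "\<And>A. A \<in> L \<Longrightarrow> f (g A) = A"
  shows "isomorphic_to L M"
proof -
  have "Vector_Spaces.linear (*s) mscale f"
    using assms(1,2) by (intro Vector_Spaces.linear_iff[THEN iffD2] conjI)
      (auto intro: vec.vector_space_axioms gl.vector_space_axioms)
  moreover have "bij_betw f UNIV L"
    by (rule bij_betw_byWitness[where f' = g]) (use assms(4-6) in auto)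
  ultimately show ?thesis
    unfolding isomorphic_to_def using assms(3) by blast
qed

lemma vector_4:
  fixes a b c d :: complex
  shows "(vector [a, b, c, d] :: complex^4) $ 1 = a" "(vector [a, b, c, d] :: complex^4) $ 2 = b"
    "(vector [a, b, c, d] :: complex^4) $ 3 = c" "(vector [a, b, c, d] :: complex^4) $ 4 = d"
  by (simp_all add: vector_def)

lemmas M_defs = M8_def M12_def M13_def M14_def pair_def zb_def axis_def
lemmas chevalley_simps = chevalley_add chevalley_scale chevalley_commutator chevalley_eq_iff

text \<open>The images of \<open>zb 1\<close> and \<open>zb 3\<close> form the basis of the torus
  dual to the roots of \<open>x1\<close> and \<open>x3\<close>. As \<open>x1\<close> and
  \<open>x3\<close> commute, the algebra splits into two copies of the two-dimensional nonabelian
  algebra.\<close>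

lemma isomorphic_alg8_1: "isomorphic_to alg8_1 M8"
proof (rule isomorphic_toI[where
      f = "\<lambda>u. chevalley ((u$1 + u$3) / 3) ((2 * u$3 - u$1) / 3) (u$2) 0 (u$4) 0 0 0" and
      g = "\<lambda>A. vector [2 * A$1$1 + A$3$3, A$1$2, A$1$1 - A$3$3, - A$1$3]"])
  show "chevalley ((u$1 + u$3) / 3) ((2 * u$3 - u$1) / 3) (u$2) 0 (u$4) 0 0 0 \<in> alg8_1"
    for u :: "complex^4" unfolding alg8_1_def by blast
qed (auto simp: alg8_1_def chevalley_simps M_defs vector_4 vec_eq_iff[where 'b=4] forall_4 field_simps)

text \<open>The same splitting with \<open>y2\<close> in place of \<open>x3\<close>: the toral basis
  is now dual to the roots of \<open>x1\<close> and \<open>y2\<close>.\<close>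

lemma isomorphic_alg8_2: "isomorphic_to alg8_2 M8"
proof (rule isomorphic_toI[where
      f = "\<lambda>u. chevalley ((2 * u$1 - u$3) / 3) ((u$1 - 2 * u$3) / 3) (u$2) 0 0 0 (u$4) 0" and
      g = "\<lambda>A. vector [2 * A$1$1 + A$3$3, A$1$2, A$1$1 + 2 * A$3$3, A$3$2]"])
  show "chevalley ((2 * u$1 - u$3) / 3) ((u$1 - 2 * u$3) / 3) (u$2) 0 0 0 (u$4) 0 \<in> alg8_2"
    for u :: "complex^4" unfolding alg8_2_def by blast
qed (auto simp: alg8_2_def chevalley_simps M_defs vector_4 vec_eq_iff[where 'b=4] forall_4 field_simps)

lemma isomorphic_toral_nil_M12: "isomorphic_to (toral_nil 1 1) M12"
  by (rule isomorphic_toI[where f = "\<lambda>u. chevalley (u$4) (u$4) (u$1) (u$3) (u$2) 0 0 0" and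
      g = "\<lambda>A. vector [A$1$2, - A$1$3, A$2$3, A$1$1]"])
    (auto simp: toral_nil_def chevalley_simps M_defs vector_4 vec_eq_iff[where 'b=4] forall_4 algebra_simps)

text \<open>A third of \<open>h1 - h2\<close> has weights 1, -1 and 0 on \<open>x1\<close>,
  \<open>x2\<close> and \<open>x3\<close>, so it exchanges \<open>x1 - x2\<close> and
  \<open>x1 + x2\<close>, the images of \<open>zb 1\<close> and \<open>zb 3\<close>.\<close>

lemma isomorphic_toral_nil_M14: "isomorphic_to (toral_nil 1 (-1)) M14"
proof (rule isomorphic_toI[where
      f = "\<lambda>u. chevalley (u$4 / 3) (- u$4 / 3) (u$1 + u$3) (u$3 - u$1) (2 * u$2) 0 0 0" and
      g = "\<lambda>A. vector [(A$1$2 - A$2$3) / 2, - A$1$3 / 2, (A$1$2 + A$2$3) / 2, 3 * A$1$1]"])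
  show "chevalley (u$4 / 3) (- u$4 / 3) (u$1 + u$3) (u$3 - u$1) (2 * u$2) 0 0 0 \<in> toral_nil 1 (-1)"
    for u :: "complex^4" using toral_nil_member[of "u$4 / 3" 1 "-1"] by simp
qed (auto simp: toral_nil_def chevalley_simps M_defs vector_4 vec_eq_iff[where 'b=4] forall_4 field_simps)

text \<open>The generator with toral coordinates \<open>p\<close>, \<open>q\<close> has weight
  \<open>p + q = 1\<close> on \<open>x3\<close> and weights \<open>2 * p - q\<close>,
  \<open>2 * q - p\<close> on \<open>x1\<close>, \<open>x2\<close>; the latter have sum 1 and
  product minus the parameter of \<open>M13\<close>. Sending \<open>zb 3\<close> to
  \<open>x1 + x2\<close> and \<open>zb 1\<close> to the image of \<open>x1 + x2\<close> under the
  generator makes the bracket of \<open>zb 4\<close> with \<open>zb 1\<close> an instance of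
  Cayley-Hamilton. The two weights differ by \<open>3 * (p - q)\<close>, so
  \<open>p \<noteq> q\<close> keeps these images independent.\<close>

lemma isomorphic_toral_nil_M13:
  assumes "p + q = 1" "p \<noteq> q"
  shows "isomorphic_to (toral_nil p q) (M13 ((2 * p - q) * (p - 2 * q)))"
proof -
  define f where "f u = chevalley (u$4 * p) (u$4 * q) ((2 * p - q) * u$1 + u$3)
    ((2 * q - p) * u$1 + u$3) (3 * (p - q) * u$2) 0 0 0" for u :: "complex^4"
  define g :: "complex^3^3 \<Rightarrow> complex^4" where
    "g A = (let t = (A$1$2 - A$2$3) / (3 * (p - q)) in
      vector [t, - A$1$3 / (3 * (p - q)), A$1$2 - (2 * p - q) * t, A$1$1 - A$3$3])" for A
  have q: "q = 1 - p" using assms(1) by algebra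
  have nz: "3 * (p - q) \<noteq> 0" using assms(2) by simp
  show ?thesis
  proof (rule isomorphic_toI)
    show "g (f u) = u" for u
    proof -
      have "(2 * p - q) * u$1 + u$3 - ((2 * q - p) * u$1 + u$3) = u$1 * (3 * (p - q))"
        by algebra
      then have "((2 * p - q) * u$1 + u$3 - ((2 * q - p) * u$1 + u$3)) / (3 * (p - q)) = u$1"
        using nz by (metis nonzero_mult_div_cancel_right)
      moreover have "u$4 * p + u$4 * q = u$4" using assms(1) by algebra
      ultimately show ?thesis
        unfolding g_def f_def chevalley_entries using nz by (simp add: vector_4 vec_eq_iff forall_4)
    qed
    show "f (g A) = A" if "A \<in> toral_nil p q" for A
    proof -
      from that obtain s c d e where A: "A = chevalley (s * p) (s * q) c d e 0 0 0"
        unfolding toral_nil_def by auto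
      define t where "t = (c - d) / (3 * (p - q))"
      have t: "3 * (p - q) * t = c - d" using nz by (simp add: t_def)
      have "(2 * q - p) * t + (c - (2 * p - q) * t) = d" using t by algebra
      moreover have "s * p + s * q = s" using assms(1) by algebra
      ultimately show ?thesis
        using nz unfolding f_def g_def A chevalley_entries Let_def vector_4 t_def[symmetric]
        by (simp add: chevalley_eq_iff)
    qed
    show "f (M13 ((2 * p - q) * (p - 2 * q)) u v) = commutator (f u) (f v)" for u v
      unfolding f_def chevalley_commutator chevalley_eq_iff by (simp add: M_defs q; algebra)
    show "f u \<in> toral_nil p q" for u unfolding f_def by (rule toral_nil_member)
  qed (auto simp: f_def chevalley_simps algebra_simps)
qed

lemma toral_nil_scale:
  assumes "k \<noteq> 0"
  shows "toral_nil (k * p) (k * q) = toral_nil p q"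
proof
  show sub: "toral_nil (k * p) (k * q) \<subseteq> toral_nil p q" for k p q
    unfolding toral_nil_def by (auto simp: mult.assoc[symmetric])
  show "toral_nil p q \<subseteq> toral_nil (k * p) (k * q)"
    using sub[of "inverse k" "k * p" "k * q"] assms by (simp add: mult.assoc[symmetric])
qed

lemma isomorphic_toral_nil_L13:
  assumes "\<alpha> \<noteq> 1" "\<alpha> \<noteq> -1"
  shows "isomorphic_to (toral_nil \<alpha> 1) (M13 ((2 * \<alpha> - 1) * (\<alpha> - 2) / (\<alpha> + 1)\<^sup>2))"
proof -
  have nz: "\<alpha> + 1 \<noteq> 0" using assms(2) by (simp add: add_eq_0_iff2)
  \<comment> \<open>Dividing by \<open>\<alpha> + 1\<close> gives the toral generator weight 1 on
    \<open>x3\<close>.\<close>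
  define k where "k = inverse (\<alpha> + 1)"
  have "isomorphic_to (toral_nil (k * \<alpha>) (k * 1)) (M13 ((2 * (k * \<alpha>) - k * 1) * (k * \<alpha> - 2 * (k * 1))))"
    by (rule isomorphic_toral_nil_M13) (use nz assms in \<open>simp_all add: k_def field_simps\<close>)
  also have "(2 * (k * \<alpha>) - k * 1) * (k * \<alpha> - 2 * (k * 1)) = (2 * \<alpha> - 1) * (\<alpha> - 2) * k\<^sup>2"
    by algebra
  also have "\<dots> = (2 * \<alpha> - 1) * (\<alpha> - 2) / (\<alpha> + 1)\<^sup>2"
    by (simp add: k_def divide_inverse power_inverse)
  finally show ?thesis
    using toral_nil_scale[of k \<alpha> 1] nz by (simp add: k_def)
qed

section \<open>Finite dimensionality and conjugation\<close>

text \<open>Indexing vectors by pairs identifies them linearly with matrices; the standard basis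
  carried over by this map makes dimension theory available for \<open>mscale\<close>.\<close>

definition mat_of_vec :: "complex^('n \<times> 'n) \<Rightarrow> complex^'n^'n" where
  "mat_of_vec v = (\<chi> i j. v $ (i, j))"

lemma linear_mat_of_vec: "Vector_Spaces.linear (*s) mscale mat_of_vec"
  by (intro Vector_Spaces.linear_iff[THEN iffD2] conjI)
    (auto intro: vec.vector_space_axioms gl.vector_space_axioms simp: mat_of_vec_def mscale_def vec_eq_iff)

lemma bij_mat_of_vec: "bij (mat_of_vec :: complex^('n::finite \<times> 'n) \<Rightarrow> complex^'n^'n)"
  by (rule o_bij[where g = "\<lambda>A. \<chi> p. A $ fst p $ snd p"])
    (auto simp: mat_of_vec_def vec_eq_iff)

interpretation mat_of_vec: Vector_Spaces.linear "(*s)" mscale mat_of_vec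
  by (rule linear_mat_of_vec)

interpretation gl: finite_dimensional_vector_space
  "mscale :: complex \<Rightarrow> complex^'n^'n \<Rightarrow> complex^'n^'n" "mat_of_vec ` cart_basis"
proof
  show "finite (mat_of_vec ` cart_basis :: (complex^'n^'n) set)"
    by (simp add: finite_cart_basis)
  show "gl.independent (mat_of_vec ` cart_basis :: (complex^'n^'n) set)"
    by (intro mat_of_vec.independent_injective_image independent_cart_basis
        inj_on_subset[OF bij_is_inj[OF bij_mat_of_vec]]) simp
  show "gl.span (mat_of_vec ` cart_basis :: (complex^'n^'n) set) = UNIV"
    by (simp add: mat_of_vec.span_image bij_is_surj[OF bij_mat_of_vec])
qed

interpretation vm: finite_dimensional_vector_space_pair
  "(*s) :: complex \<Rightarrow> complex^'m \<Rightarrow> complex^'m" cart_basis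
  "mscale :: complex \<Rightarrow> complex^'n^'n \<Rightarrow> complex^'n^'n" "mat_of_vec ` cart_basis" ..

interpretation mm: finite_dimensional_vector_space_pair
  "mscale :: complex \<Rightarrow> complex^'n^'n \<Rightarrow> complex^'n^'n" "mat_of_vec ` cart_basis"
  "mscale :: complex \<Rightarrow> complex^'n^'n \<Rightarrow> complex^'n^'n" "mat_of_vec ` cart_basis" ..

lemma dim_isomorphic_to:
  assumes "isomorphic_to L M"
  shows "gl.dim L = 4"
proof -
  obtain f :: "complex^4 \<Rightarrow> complex^3^3" where f: "Vector_Spaces.linear (*s) mscale f" "bij_betw f UNIV L"
    using assms unfolding isomorphic_to_def by blast
  have "gl.dim (f ` UNIV) = vec.dim (UNIV :: (complex^4) set)"
    using f by (intro vm.dim_image_eq) (auto simp: bij_betw_def)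
  then show ?thesis
    using f(2) vec.dim_UNIV by (simp add: bij_betw_def vec_dim_card card_cart_basis)
qed

section \<open>Conjugation by matrices of determinant one\<close>

lemma matrix_inv_cancel:
  fixes g :: "complex^'n^'n"
  assumes "det g = 1"
  shows "g ** matrix_inv g = mat 1" "matrix_inv g ** g = mat 1"
proof -
  have "invertible g" using assms by (simp add: invertible_det_nz)
  then have "g ** matrix_inv g = mat 1 \<and> matrix_inv g ** g = mat 1"
    unfolding invertible_def matrix_inv_def by (rule someI_ex)
  then show "g ** matrix_inv g = mat 1" "matrix_inv g ** g = mat 1" by auto
qed

lemma conjugate_eq_iff:
  fixes g A B :: "complex^'n^'n"
  assumes "det g = 1"
  shows "g ** A ** matrix_inv g = B \<longleftrightarrow> g ** A = B ** g"
proof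
  assume "g ** A = B ** g"
  then show "g ** A ** matrix_inv g = B"
    by (simp add: matrix_mul_assoc[symmetric] matrix_inv_cancel[OF assms])
qed (auto simp: matrix_mul_assoc[symmetric] matrix_inv_cancel[OF assms])

text \<open>The intertwining equation is free of the inverse, so its entries are polynomial
  equations in the entries of \<open>g\<close>.\<close>

lemma equivalent_iff:
  "equivalent L L' \<longleftrightarrow> (\<exists>g. det g = 1 \<and> (\<forall>A\<in>L. \<exists>B\<in>L'. g ** A = B ** g) \<and> (\<forall>B\<in>L'. \<exists>A\<in>L. g ** A = B ** g))"
proof -
  have "(\<lambda>A. g ** A ** matrix_inv g) ` L = L' \<longleftrightarrow>
      (\<forall>A\<in>L. \<exists>B\<in>L'. g ** A = B ** g) \<and> (\<forall>B\<in>L'. \<exists>A\<in>L. g ** A = B ** g)" if "det g = 1" for g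
    unfolding set_eq_iff image_iff conjugate_eq_iff[OF that, symmetric] by metis
  then show ?thesis
    unfolding equivalent_def by (intro ex_cong1 conj_cong refl)
qed

lemma equivalent_refl: "equivalent L L"
  unfolding equivalent_iff by (rule exI[of _ "mat 1"]) auto

lemma equivalent_trans:
  assumes "equivalent L L'" "equivalent L' L''"
  shows "equivalent L L''"
proof -
  obtain g where g: "det g = 1" "\<forall>A\<in>L. \<exists>B\<in>L'. g ** A = B ** g" "\<forall>B\<in>L'. \<exists>A\<in>L. g ** A = B ** g"
    using assms(1) unfolding equivalent_iff by blast
  obtain h where h: "det h = 1" "\<forall>A\<in>L'. \<exists>B\<in>L''. h ** A = B ** h" "\<forall>B\<in>L''. \<exists>A\<in>L'. h ** A = B ** h"
    using assms(2) unfolding equivalent_iff by blast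
  have comp: "(h ** g) ** A = C ** (h ** g)" if "g ** A = B ** g" "h ** B = C ** h" for A B C
    using that by (metis matrix_mul_assoc)
  show ?thesis
    unfolding equivalent_iff
  proof (intro exI conjI)
    show "det (h ** g) = 1" using g(1) h(1) by (simp add: det_mul)
    show "\<forall>A\<in>L. \<exists>B\<in>L''. (h ** g) ** A = B ** (h ** g)" using g(2) h(2) comp by meson
    show "\<forall>B\<in>L''. \<exists>A\<in>L. (h ** g) ** A = B ** (h ** g)" using g(3) h(3) comp by meson
  qed
qed

lemma A2_subalgebra_conjugate:
  assumes "det g = 1" "A2_subalgebra L"
  shows "A2_subalgebra ((\<lambda>A. g ** A ** matrix_inv g) ` L)" (is "A2_subalgebra (?f ` L)")
    and "gl.dim ((\<lambda>A. g ** A ** matrix_inv g) ` L) = gl.dim L"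
proof -
  have cancel: "matrix_inv g ** (g ** X) = X" for X
    by (simp add: matrix_mul_assoc matrix_inv_cancel(2)[OF assms(1)])
  have mult: "?f A ** ?f B = ?f (A ** B)" for A B
    by (simp add: matrix_mul_assoc[symmetric] cancel)
  have f: "?f (A + B) = ?f A + ?f B" "?f (mscale c A) = mscale c (?f A)" 
     "?f (commutator A B) = commutator (?f A) (?f B)" "?f 0 = 0" for A B c
    by (simp_all add: matrix_add_ldistrib matrix_add_rdistrib' mscale_mult_left mscale_mult_right
      commutator_def mult matrix_sub_ldistrib matrix_sub_rdistrib)
  have tr: "trace (?f A) = trace A" for A
    by (subst trace_mul_sym) (simp add: cancel)
  have L: "L \<subseteq> A2" using assms(2) by (simp add: A2_subalgebra_def)
  note D = A2_subalgebraD[OF assms(2)]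
  show "A2_subalgebra (?f ` L)"
  proof (rule A2_subalgebraI)
    show "?f ` L \<subseteq> A2" using L tr by (auto simp: A2_def)
    show "0 \<in> ?f ` L" by (rule image_eqI[where x = 0]) (use D(1) in simp_all)
  next
    fix X k assume "X \<in> ?f ` L"
    then obtain A where A: "X = ?f A" "A \<in> L" by blast
    show "mscale k X \<in> ?f ` L" unfolding A f(2)[symmetric] using A(2) D(3) by blast
    fix Y assume "Y \<in> ?f ` L"
    then obtain B where B: "Y = ?f B" "B \<in> L" by blast
    show "X + Y \<in> ?f ` L" unfolding A B f(1)[symmetric] using A(2) B(2) D(2) by blast
    show "commutator X Y \<in> ?f ` L" unfolding A B f(3)[symmetric] using A(2) B(2) D(4) by blast
  qed
  have "Vector_Spaces.linear mscale mscale ?f"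
    using f by (intro Vector_Spaces.linear_iff[THEN iffD2] conjI) (auto intro: gl.vector_space_axioms)
  moreover have "inj ?f"
    by (rule inj_on_inverseI[where g = "\<lambda>A. matrix_inv g ** A ** g"])
      (simp add: matrix_mul_assoc[symmetric] cancel matrix_inv_cancel(2)[OF assms(1)])
  ultimately show "gl.dim (?f ` L) = gl.dim L"
    by (intro mm.dim_image_eq) (auto simp: inj_on_def)
qed

section \<open>Eigenvectors in invariant subspaces\<close>

definition krylov :: "complex^'n^'n \<Rightarrow> complex^'n \<Rightarrow> nat \<Rightarrow> (complex^'n) set" where
  "krylov A v m = vec.span ((\<lambda>i. ((*v) A ^^ i) v) ` {..<m})"

lemma subspace_krylov: "vec.subspace (krylov A v m)"
  by (simp add: krylov_def)

lemma krylov_0: "krylov A v 0 = {0}"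
  by (simp add: krylov_def)

lemma krylov_mono: "m \<le> n \<Longrightarrow> krylov A v m \<subseteq> krylov A v n"
  unfolding krylov_def by (intro vec.span_mono image_mono) auto

lemma power_in_krylov: "i < m \<Longrightarrow> ((*v) A ^^ i) v \<in> krylov A v m"
  unfolding krylov_def by (intro vec.span_base) auto

lemma mult_krylov:
  assumes "x \<in> krylov A v m"
  shows "A *v x \<in> krylov A v (Suc m)"
proof -
  have "A *v x \<in> (*v) A ` vec.span ((\<lambda>i. ((*v) A ^^ i) v) ` {..<m})"
    using assms by (auto simp: krylov_def)
  also have "\<dots> = vec.span ((*v) A ` (\<lambda>i. ((*v) A ^^ i) v) ` {..<m})"
    by (simp add: vec.span_image)
  also have "\<dots> \<subseteq> krylov A v (Suc m)"
    unfolding krylov_def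
  proof (intro vec.span_mono subsetI)
    fix y assume "y \<in> (*v) A ` (\<lambda>i. ((*v) A ^^ i) v) ` {..<m}"
    then obtain i where "i < m" "y = ((*v) A ^^ Suc i) v" by auto
    then show "y \<in> (\<lambda>i. ((*v) A ^^ i) v) ` {..<Suc m}" by blast
  qed
  finally show ?thesis .
qed

text \<open>If every iterate were independent of the earlier ones, their spans would attain every
  finite dimension.\<close>

lemma krylov_stabilizes: "\<exists>m. ((*v) A ^^ m) v \<in> krylov A v m"
proof (rule ccontr)
  assume contra: "\<nexists>m. ((*v) A ^^ m) v \<in> krylov A v m"
  have dim: "vec.dim ((\<lambda>i. ((*v) A ^^ i) v) ` {..<m}) = m" for m
  proof (induction m)
    case (Suc m)
    then show ?case
      using contra by (simp add: lessThan_Suc vec.dim_insert krylov_def)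
  qed simp
  then show False
    using vec.dim_subset_UNIV[of "(\<lambda>i. ((*v) A ^^ i) v) ` {..<Suc (vec.dimension TYPE(complex) TYPE('a))}"]
    by simp
qed

text \<open>This is the polynomial \<open>p\<close> evaluated at \<open>A\<close> and applied to
  \<open>v\<close>, by Horner's rule.\<close>

definition poly_app :: "complex^'n^'n \<Rightarrow> complex^'n \<Rightarrow> complex poly \<Rightarrow> complex^'n" where
  "poly_app A v p = fold_coeffs (\<lambda>a x. a *s v + A *v x) p 0"

lemma poly_app_0 [simp]: "poly_app A v 0 = 0"
  by (simp add: poly_app_def)

lemma poly_app_pCons [simp]: "poly_app A v (pCons a p) = a *s v + A *v poly_app A v p"
  by (cases "p = 0 \<and> a = 0") (auto simp: poly_app_def)

lemma poly_app_add: "poly_app A v (p + q) = poly_app A v p + poly_app A v q"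
  by (induction p q rule: poly_induct2)
    (simp_all add: matrix_vector_right_distrib vector_sadd_rdistrib algebra_simps)

lemma poly_app_smult: "poly_app A v (smult c p) = c *s poly_app A v p"
  by (induction p) (simp_all add: vec.scale vector_add_ldistrib vector_smult_assoc)

lemma poly_app_linear_factor:
  "poly_app A v ([:- r, 1:] * q) = A *v poly_app A v q - r *s poly_app A v q"
proof -
  have "[:- r, 1:] * q = smult (- r) q + pCons 0 q" by simp
  then show ?thesis
    by (simp only: poly_app_add poly_app_smult poly_app_pCons) simp
qed

lemma poly_app_monom: "poly_app A v (monom 1 m) = ((*v) A ^^ m) v"
  by (induction m) (simp_all add: monom_Suc monom_0)

lemma poly_app_in_invariant_subspace:
  assumes "vec.subspace W" "\<And>x. x \<in> W \<Longrightarrow> A *v x \<in> W" "v \<in> W"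
  shows "poly_app A v p \<in> W"
  by (induction p) (use assms in \<open>auto simp: vec.subspace_def\<close>)

lemma krylov_poly_app:
  assumes "x \<in> krylov A v m"
  obtains p where "poly_app A v p = x" "\<And>i. i \<ge> m \<Longrightarrow> coeff p i = 0"
proof -
  let ?P = "{poly_app A v p | p. \<forall>i\<ge>m. coeff p i = 0}"
  have "vec.subspace ?P"
    unfolding vec.subspace_def
  proof (intro conjI ballI allI)
    show "0 \<in> ?P" by (force intro: exI[of _ 0])
  next
    fix x y assume "x \<in> ?P" "y \<in> ?P"
    then show "x + y \<in> ?P"
      by clarify (metis (no_types, lifting) poly_app_add coeff_add add_0)
  next
    fix x c assume "x \<in> ?P"
    then show "c *s x \<in> ?P"
      by clarify (metis (no_types, lifting) poly_app_smult coeff_smult mult_zero_right)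
  qed
  moreover have "(\<lambda>i. ((*v) A ^^ i) v) ` {..<m} \<subseteq> ?P"
    by (force intro: exI[of _ "monom 1 _"] simp: poly_app_monom[symmetric])
  ultimately have "krylov A v m \<subseteq> ?P"
    unfolding krylov_def by (rule vec.span_minimal[rotated])
  with assms that show ?thesis by blast
qed

text \<open>Among the nonzero polynomials annihilating some nonzero \<open>x\<close> in
  \<open>W\<close>, take one of least degree and split off a root \<open>r\<close>. The cofactor
  applied to \<open>x\<close> is nonzero by minimality, lies in \<open>W\<close>, and is an
  eigenvector for \<open>r\<close>.\<close>

lemma eigenvector_in_invariant_subspace:
  fixes A :: "complex^'n^'n"
  assumes "vec.subspace W" "\<And>x. x \<in> W \<Longrightarrow> A *v x \<in> W" "W \<noteq> {0}"
  obtains v c where "v \<in> W" "v \<noteq> 0" "A *v v = c *s v"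
proof -
  obtain x where x: "x \<in> W" "x \<noteq> 0"
    using assms(1,3) by (auto simp: vec.subspace_def)
  obtain m where "((*v) A ^^ m) x \<in> krylov A x m" using krylov_stabilizes by blast
  then obtain p where p: "poly_app A x p = ((*v) A ^^ m) x" "\<And>i. i \<ge> m \<Longrightarrow> coeff p i = 0"
    by (rule krylov_poly_app) blast
  have "poly_app A x (monom 1 m + smult (-1) p) = 0"
    by (simp only: poly_app_add poly_app_smult poly_app_monom p(1)) simp
  moreover have "coeff (monom 1 m + smult (-1) p) m \<noteq> 0" using p(2) by simp
  then have "monom 1 m + smult (-1) p \<noteq> 0" by (metis coeff_0)
  ultimately obtain f where f: "f \<noteq> 0" "poly_app A x f = 0"
    and least: "\<And>q. q \<noteq> 0 \<and> poly_app A x q = 0 \<Longrightarrow> degree f \<le> degree q"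
    using ex_has_least_nat[of "\<lambda>q. q \<noteq> 0 \<and> poly_app A x q = 0" _ degree] by blast
  have "degree f \<noteq> 0"
  proof
    assume "degree f = 0"
    then obtain c where "f = [:c:]" by (metis degree_eq_zeroE)
    with f x show False by simp
  qed
  then obtain r where "poly f r = 0"
    using fundamental_theorem_of_algebra[of f] by (auto simp: constant_degree)
  then obtain q where q: "f = [:- r, 1:] * q" by (metis poly_eq_0_iff_dvd dvdE)
  then have "q \<noteq> 0" using f by auto
  then have "degree f = Suc (degree q)" unfolding q by (subst degree_mult_eq) auto
  then have "poly_app A x q \<noteq> 0" using least \<open>q \<noteq> 0\<close> by fastforce
  moreover have "poly_app A x q \<in> W" using assms x by (intro poly_app_in_invariant_subspace)
  moreover have "A *v poly_app A x q = r *s poly_app A x q"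
    using f(2) unfolding q poly_app_linear_factor by simp
  ultimately show ?thesis using that by blast
qed

section \<open>Lie's theorem\<close>

lemma commutator_mult_vector:
  "commutator A B *v x = A *v (B *v x) - B *v (A *v x)"
  by (simp add: commutator_def matrix_vector_mult_diff_rdistrib matrix_vector_mul_assoc)

lemma mscale_mult_vector: "mscale c A *v x = c *s (A *v x)"
  by (simp add: mscale_def matrix_vector_mult_def vec_eq_iff sum_distrib_left mult.assoc)

text \<open>Each induction step moves \<open>k\<close> past one factor \<open>X\<close> at the cost
  of \<open>commutator k X\<close>, which lies in \<open>K\<close> again; the induction hypothesis
  is therefore applied to both \<open>k\<close> and the commutator.\<close>

lemma weight_expansion:
  assumes "\<And>k. k \<in> K \<Longrightarrow> k *v v = \<mu> k *s v"
    and "\<And>k. k \<in> K \<Longrightarrow> commutator k X \<in> K"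
    and "k \<in> K"
  shows "k *v ((*v) X ^^ m) v - \<mu> k *s ((*v) X ^^ m) v
      - (of_nat m * \<mu> (commutator k X)) *s ((*v) X ^^ (m - 1)) v \<in> krylov X v (m - 1)"
  using assms(3)
proof (induction m arbitrary: k)
  case 0
  then show ?case using assms(1) by (simp add: krylov_0)
next
  case (Suc m)
  define w where "w = ((*v) X ^^ m) v"
  define w' where "w' = ((*v) X ^^ (m - 1)) v"
  define k' where "k' = commutator k X"
  have k': "k' \<in> K" using assms(2) Suc.prems by (simp add: k'_def)
  define u where "u = k *v w - \<mu> k *s w - (of_nat m * \<mu> k') *s w'"
  define u' where "u' = k' *v w - \<mu> k' *s w - (of_nat m * \<mu> (commutator k' X)) *s w'"
  have u: "u \<in> krylov X v (m - 1)" "u' \<in> krylov X v (m - 1)"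
    using Suc.IH[OF Suc.prems] Suc.IH[OF k'] by (simp_all add: u_def u'_def w_def w'_def k'_def)
  have Xu: "X *v u \<in> krylov X v m" and u': "u' \<in> krylov X v m"
  proof -
    show "u' \<in> krylov X v m" using u(2) krylov_mono[of "m - 1" m] by auto
    show "X *v u \<in> krylov X v m"
      using mult_krylov[OF u(1)] u(1) by (cases m) (auto simp: krylov_0)
  qed
  \<comment> \<open>For \<open>m = 0\<close> truncated subtraction makes \<open>w'\<close> equal to
    \<open>w\<close>, but the factor \<open>of_nat m\<close> is then zero.\<close>
  have Xw': "of_nat m *s (X *v w') = of_nat m *s w"
    by (cases m) (simp_all add: w_def w'_def)
  have mw': "(of_nat m * c) *s w' \<in> krylov X v m" for c
  proof (cases m)
    case (Suc n)
    then have "w' \<in> krylov X v m" unfolding w'_def by (intro power_in_krylov) simp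
    then show ?thesis by (intro vec.subspace_scale[OF subspace_krylov])
  qed (simp add: krylov_0)
  have "k *v (X *v w) = X *v (k *v w) + k' *v w"
    by (simp add: k'_def commutator_mult_vector)
  also have "k *v w = \<mu> k *s w + (of_nat m * \<mu> k') *s w' + u" by (simp add: u_def)
  also have "X *v \<dots> = \<mu> k *s (X *v w) + \<mu> k' *s (of_nat m *s (X *v w')) + X *v u"
    by (simp add: matrix_vector_right_distrib vec.scale vector_smult_assoc mult.commute)
  also have "k' *v w = \<mu> k' *s w + (of_nat m * \<mu> (commutator k' X)) *s w' + u'" by (simp add: u'_def)
  finally have "k *v (X *v w) - \<mu> k *s (X *v w) - (of_nat (Suc m) * \<mu> k') *s w =
      X *v u + (of_nat m * \<mu> (commutator k' X)) *s w' + u'"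
    unfolding Xw' by (simp add: algebra_simps vector_sadd_rdistrib vector_smult_assoc)
  also have "\<dots> \<in> krylov X v m"
    by (intro vec.subspace_add[OF subspace_krylov] Xu u' mw')
  finally show ?case by (simp add: w_def k'_def)
qed

text \<open>Instead of comparing traces on the cyclic subspace generated by \<open>v\<close> under \<open>X\<close>, take the least \<open>m\<close>
  such that \<open>X\<^sup>m v\<close> depends on the lower powers. Since \<open>k - \<mu> k\<close> lowers the Krylov filtration,
  \<open>m * \<mu> [k, X]\<close> times \<open>X\<^sup>m\<^sup>-\<^sup>1 v\<close> lies in the span of the lower powers, which forces
  \<open>\<mu> [k, X] = 0\<close>.\<close>

lemma weight_vanishes_on_commutators:
  assumes "v \<noteq> 0" "\<And>k. k \<in> K \<Longrightarrow> k *v v = \<mu> k *s v"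
    and "\<And>k. k \<in> K \<Longrightarrow> commutator k X \<in> K" "k \<in> K"
  shows "\<mu> (commutator k X) = 0"
proof (rule ccontr)
  define c where "c = \<mu> (commutator k X)"
  assume "\<mu> (commutator k X) \<noteq> 0"
  then have c: "c \<noteq> 0" by (simp add: c_def)
  define m where "m = (LEAST m. ((*v) X ^^ m) v \<in> krylov X v m)"
  have m: "((*v) X ^^ m) v \<in> krylov X v m"
    unfolding m_def using krylov_stabilizes by (rule LeastI_ex)
  have least: "((*v) X ^^ i) v \<notin> krylov X v i" if "i < m" for i
    using that unfolding m_def by (rule not_less_Least)
  have "m \<noteq> 0" using m assms(1) by (intro notI) (simp add: krylov_0)
  then obtain n where n: "m = Suc n" using not0_implies_Suc by blast
  let ?D = "\<lambda>x. k *v x - \<mu> k *s x"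
  have expansion: "?D (((*v) X ^^ i) v) - (of_nat i * c) *s ((*v) X ^^ (i - 1)) v \<in> krylov X v (i - 1)" for i
    using weight_expansion[of K v \<mu> X k i, OF assms(2,3,4)] by (simp add: c_def)
  have "?D x \<in> krylov X v n" if "x \<in> krylov X v m" for x
  proof -
    have "vec.subspace {x. ?D x \<in> krylov X v n}"
    proof (unfold vec.subspace_def mem_Collect_eq, intro conjI ballI allI)
      show "?D 0 \<in> krylov X v n" by (simp add: vec.subspace_0[OF subspace_krylov])
    next
      fix x y assume "x \<in> {x. ?D x \<in> krylov X v n}" "y \<in> {x. ?D x \<in> krylov X v n}"
      then have "?D x + ?D y \<in> krylov X v n"
        unfolding mem_Collect_eq by (rule vec.subspace_add[OF subspace_krylov])
      then show "?D (x + y) \<in> krylov X v n"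
        by (simp add: matrix_vector_right_distrib vector_add_ldistrib algebra_simps)
    next
      fix x a assume "x \<in> {x. ?D x \<in> krylov X v n}"
      then have "a *s ?D x \<in> krylov X v n"
        unfolding mem_Collect_eq by (rule vec.subspace_scale[OF subspace_krylov])
      then show "?D (a *s x) \<in> krylov X v n"
        by (simp add: vec.scale vector_ssub_ldistrib vector_smult_assoc mult.commute)
    qed
    moreover have "?D (((*v) X ^^ i) v) \<in> krylov X v n" if "i < m" for i
    proof -
      have "(of_nat i * c) *s ((*v) X ^^ (i - 1)) v \<in> krylov X v n"
      proof (cases i)
        case (Suc j)
        then have "((*v) X ^^ (i - 1)) v \<in> krylov X v n"
          using that n by (intro power_in_krylov) simp
        then show ?thesis by (intro vec.subspace_scale[OF subspace_krylov])
      qed (simp add: vec.subspace_0[OF subspace_krylov])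
      moreover have "krylov X v (i - 1) \<subseteq> krylov X v n"
        using that n by (intro krylov_mono) simp
      ultimately have "?D (((*v) X ^^ i) v) - (of_nat i * c) *s ((*v) X ^^ (i - 1)) v
          + (of_nat i * c) *s ((*v) X ^^ (i - 1)) v \<in> krylov X v n"
        using expansion[of i] by (intro vec.subspace_add[OF subspace_krylov]) blast+
      then show ?thesis by simp
    qed
    ultimately have "krylov X v m \<subseteq> {x. ?D x \<in> krylov X v n}"
      unfolding krylov_def[of X v m] by (intro vec.span_minimal) auto
    with that show ?thesis by auto
  qed
  then have "?D (((*v) X ^^ m) v) \<in> krylov X v n" using m by blast
  moreover have "?D (((*v) X ^^ m) v) - (of_nat m * c) *s ((*v) X ^^ n) v \<in> krylov X v n"
    using expansion[of m] by (simp only: n diff_Suc_1)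
  ultimately have "?D (((*v) X ^^ m) v) - (?D (((*v) X ^^ m) v) - (of_nat m * c) *s ((*v) X ^^ n) v) \<in> krylov X v n"
    by (rule vec.subspace_diff[OF subspace_krylov])
  then have "(of_nat m * c) *s ((*v) X ^^ n) v \<in> krylov X v n" by simp
  then have "inverse (of_nat m * c) *s ((of_nat m * c) *s ((*v) X ^^ n) v) \<in> krylov X v n"
    by (rule vec.subspace_scale[OF subspace_krylov])
  moreover have nz: "of_nat m * c \<noteq> 0" using c \<open>m \<noteq> 0\<close> by simp
  ultimately have "((*v) X ^^ n) v \<in> krylov X v n"
    using nz by (simp only: vector_smult_assoc left_inverse vector_smult_lid)
  with least[of n] n show False by simp
qed

definition weight_vector :: "(complex^'n^'n) set \<Rightarrow> complex^'n \<Rightarrow> bool" where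
  "weight_vector S v \<longleftrightarrow> v \<noteq> 0 \<and> (\<forall>A\<in>S. \<exists>c. A *v v = c *s v)"

text \<open>The weight \<open>\<mu>\<close> of \<open>v\<close> vanishes on the commutators with
  \<open>X\<close>, so the space of all vectors in \<open>W\<close> of weight \<open>\<mu>\<close>
  is invariant under \<open>X\<close>. An eigenvector of \<open>X\<close> inside it serves for
  \<open>K\<close> and \<open>X\<close> together.\<close>

lemma weight_vector_insert:
  assumes W: "vec.subspace W" "\<And>x. x \<in> W \<Longrightarrow> X *v x \<in> W"
    and v: "v \<in> W" "weight_vector K v"
    and K: "\<And>k. k \<in> K \<Longrightarrow> commutator k X \<in> K"
  shows "\<exists>u\<in>W. weight_vector (insert X K) u"
proof -
  obtain \<mu> where \<mu>: "\<And>k. k \<in> K \<Longrightarrow> k *v v = \<mu> k *s v"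
    using v(2) unfolding weight_vector_def by metis
  let ?E = "{x \<in> W. \<forall>k\<in>K. k *v x = \<mu> k *s x}"
  have "X *v x \<in> ?E" if x: "x \<in> ?E" for x
  proof (cases "x = 0")
    case False
    have "k *v (X *v x) = \<mu> k *s (X *v x)" if k: "k \<in> K" for k
    proof -
      have "\<mu> (commutator k X) = 0"
        by (rule weight_vanishes_on_commutators[OF False]) (use x K k in auto)
      then have "commutator k X *v x = 0" using x K[OF k] by simp
      then have "k *v (X *v x) = X *v (k *v x)" by (simp add: commutator_mult_vector)
      also have "\<dots> = \<mu> k *s (X *v x)" using x k by (simp add: vec.scale)
      finally show ?thesis .
    qed
    with x W(2) show ?thesis by auto
  qed (use x in auto)
  moreover have "vec.subspace ?E"
    using W(1) by (auto simp: vec.subspace_def matrix_vector_right_distrib vector_add_ldistrib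
        vec.scale vector_smult_assoc mult.commute)
  moreover have "?E \<noteq> {0}" using v \<mu> unfolding weight_vector_def by blast
  ultimately obtain u c where "u \<in> ?E" "u \<noteq> 0" "X *v u = c *s u"
    using eigenvector_in_invariant_subspace[of ?E X] by blast
  then show ?thesis unfolding weight_vector_def by auto
qed

lemma weight_vector_span:
  assumes "weight_vector S v"
  shows "weight_vector (gl.span S) v"
proof -
  have "gl.subspace {A. \<exists>c. A *v v = c *s v}"
  proof (unfold gl.subspace_def, intro conjI ballI allI)
    show "0 \<in> {A. \<exists>c. A *v v = c *s v}" by (auto intro: exI[of _ 0])
  next
    fix A B assume "A \<in> {A. \<exists>c. A *v v = c *s v}" "B \<in> {A. \<exists>c. A *v v = c *s v}"
    then obtain a b where "A *v v = a *s v" "B *v v = b *s v" by blast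
    then have "(A + B) *v v = (a + b) *s v"
      by (simp add: matrix_vector_mult_add_rdistrib vector_sadd_rdistrib)
    then show "A + B \<in> {A. \<exists>c. A *v v = c *s v}" by blast
  next
    fix A k assume "A \<in> {A. \<exists>c. A *v v = c *s v}"
    then obtain a where "A *v v = a *s v" by blast
    then have "mscale k A *v v = (k * a) *s v"
      by (simp add: mscale_mult_vector vector_smult_assoc)
    then show "mscale k A \<in> {A. \<exists>c. A *v v = c *s v}" by blast
  qed
  then have "gl.span S \<subseteq> {A. \<exists>c. A *v v = c *s v}"
    using assms by (intro gl.span_minimal) (auto simp: weight_vector_def)
  with assms show ?thesis unfolding weight_vector_def by blast
qed

lemma derived_preserves_subspace:
  assumes "vec.subspace W" "\<And>A x. A \<in> S \<Longrightarrow> x \<in> W \<Longrightarrow> A *v x \<in> W" "A \<in> gl.derived S" "x \<in> W"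
  shows "A *v x \<in> W"
proof -
  have "gl.subspace {A. \<forall>x\<in>W. A *v x \<in> W}"
    using assms(1)
    by (auto simp: gl.subspace_def vec.subspace_def matrix_vector_mult_add_rdistrib mscale_mult_vector)
  then have "gl.derived S \<subseteq> {A. \<forall>x\<in>W. A *v x \<in> W}"
    unfolding gl.derived_def using assms(1,2)
    by (intro gl.span_minimal) (auto simp: commutator_mult_vector vec.subspace_diff)
  with assms show ?thesis by auto
qed

lemma derived_subset: "gl.lie_subalgebra S \<Longrightarrow> gl.derived S \<subseteq> S"
  unfolding gl.derived_def gl.lie_subalgebra_def by (intro gl.span_minimal) auto

lemma commutator_in_derived: "A \<in> S \<Longrightarrow> B \<in> S \<Longrightarrow> commutator A B \<in> gl.derived S"
  unfolding gl.derived_def by (intro gl.span_base) auto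

lemma lie_subalgebra_derived:
  assumes "gl.lie_subalgebra S"
  shows "gl.lie_subalgebra (gl.derived S)"
  using derived_subset[OF assms] commutator_in_derived[of _ S]
  unfolding gl.lie_subalgebra_def by (auto simp: gl.derived_def gl.subspace_span)

text \<open>A weight vector of the derived algebra is improved to one of \<open>S\<close> by adjoining the elements of a
  basis of \<open>S\<close> one at a time: any set between the derived algebra and \<open>S\<close> is closed under
  commutators with elements of \<open>S\<close>.\<close>

theorem lie_theorem:
  fixes S :: "(complex^'n^'n) set"
  assumes "gl.lie_subalgebra S" "gl.solvable S" "vec.subspace W" "W \<noteq> {0}" "\<And>A x. A \<in> S \<Longrightarrow> x \<in> W \<Longrightarrow> A *v x \<in> W"
  shows "\<exists>v\<in>W. weight_vector S v"
proof -
  obtain n where "(gl.derived ^^ n) S = {0}" using assms(2) by (auto simp: gl.solvable_def)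
  then show ?thesis using assms(1,5)
  proof (induction n arbitrary: S)
    case 0
    obtain v where v: "v \<in> W" "v \<noteq> 0" using assms(3,4) vec.subspace_0 by blast
    then have "weight_vector S v"
      using 0 by (auto simp: weight_vector_def intro: exI[of _ 0])
    with v show ?case by blast
  next
    case (Suc n)
    have der: "(gl.derived ^^ n) (gl.derived S) = {0}"
      using Suc.prems(1) by (simp add: funpow_swap1)
    have inv: "A *v x \<in> W" if "A \<in> gl.derived S" "x \<in> W" for A x
      using assms(3) Suc.prems(3) that by (rule derived_preserves_subspace)
    have base: "\<exists>v\<in>W. weight_vector (gl.derived S) v"
      by (rule Suc.IH[OF der lie_subalgebra_derived[OF Suc.prems(2)] inv])
    obtain B where B: "B \<subseteq> S" "gl.independent B" "S \<subseteq> gl.span B"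
      by (rule gl.basis_exists)
    have "finite B" using B(2) by (rule gl.finiteI_independent)
    then have "\<exists>v\<in>W. weight_vector (B \<union> gl.derived S) v" using B(1)
    proof (induction B rule: finite_induct)
      case (insert X B)
      then obtain v where "v \<in> W" "weight_vector (B \<union> gl.derived S) v" by blast
      moreover have "commutator k X \<in> B \<union> gl.derived S" if "k \<in> B \<union> gl.derived S" for k
      proof -
        have "k \<in> S" "X \<in> S" using that insert.prems derived_subset[OF Suc.prems(2)] by auto
        then have "commutator k X \<in> gl.derived S" by (rule commutator_in_derived)
        then show ?thesis by simp
      qed
      ultimately show ?case
        using weight_vector_insert[OF assms(3), of X v "B \<union> gl.derived S"] Suc.prems(3) insert.prems
        by simp
    qed (use base in simp)
    then obtain v where "v \<in> W" "weight_vector (B \<union> gl.derived S) v" by blast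
    then show ?case
      using weight_vector_span[of "B \<union> gl.derived S" v] B(3) gl.span_mono[of B "B \<union> gl.derived S"]
      unfolding weight_vector_def by blast
  qed
qed

section \<open>Subalgebras of the Borel subalgebra\<close>

lemma linear_transpose: "Vector_Spaces.linear mscale mscale (transpose :: complex^'n^'n \<Rightarrow> complex^'n^'n)"
  by (intro Vector_Spaces.linear_iff[THEN iffD2] conjI)
    (auto intro: gl.vector_space_axioms simp: transpose_def mscale_def vec_eq_iff)

lemma commutator_transpose: "commutator (transpose A) (transpose B) = transpose (commutator B A)"
  by (simp add: commutator_def matrix_transpose_mul[symmetric]) (simp add: transpose_def vec_eq_iff)

lemma derived_transpose: "gl.derived (transpose ` S) = transpose ` gl.derived S"
proof -
  interpret transpose: Vector_Spaces.linear mscale mscale "transpose :: complex^'a^'a \<Rightarrow> complex^'a^'a"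
    by (rule linear_transpose)
  have "{commutator X Y | X Y. X \<in> transpose ` S \<and> Y \<in> transpose ` S} =
      transpose ` {commutator X Y | X Y. X \<in> S \<and> Y \<in> S}"
  proof (intro equalityI subsetI)
    fix Z assume "Z \<in> {commutator X Y | X Y. X \<in> transpose ` S \<and> Y \<in> transpose ` S}"
    then obtain A B where "Z = commutator (transpose A) (transpose B)" "A \<in> S" "B \<in> S" by blast
    then show "Z \<in> transpose ` {commutator X Y | X Y. X \<in> S \<and> Y \<in> S}"
      unfolding commutator_transpose by blast
  next
    fix Z assume "Z \<in> transpose ` {commutator X Y | X Y. X \<in> S \<and> Y \<in> S}"
    then obtain A B where "Z = transpose (commutator A B)" "A \<in> S" "B \<in> S" by blast
    then show "Z \<in> {commutator X Y | X Y. X \<in> transpose ` S \<and> Y \<in> transpose ` S}"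
      unfolding commutator_transpose[symmetric] by blast
  qed
  then show ?thesis by (simp add: gl.derived_def transpose.span_image)
qed

text \<open>With this, Lie's theorem applies to the transposed algebra, whose weight vectors are the
  functionals with invariant kernel.\<close>

lemma solvable_transpose:
  assumes "gl.solvable S"
  shows "gl.solvable (transpose ` S)"
proof -
  have "(gl.derived ^^ n) (transpose ` S) = transpose ` (gl.derived ^^ n) S" for n
    by (induction n) (simp_all add: derived_transpose)
  moreover have "transpose ` {0 :: complex^'a^'a} = {0}"
    by (simp add: transpose_def vec_eq_iff)
  ultimately show ?thesis using assms unfolding gl.solvable_def by metis
qed

lemma lie_subalgebra_transpose:
  assumes "gl.lie_subalgebra S"
  shows "gl.lie_subalgebra (transpose ` S)"
proof -
  interpret transpose: Vector_Spaces.linear mscale mscale "transpose :: complex^'a^'a \<Rightarrow> complex^'a^'a"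
    by (rule linear_transpose)
  show ?thesis
    using assms unfolding gl.lie_subalgebra_def
    by (auto simp: commutator_transpose intro!: transpose.subspace_image)
qed

section \<open>Invariant flags and conjugation into the Borel algebra\<close>

lemma matrix_vector_entry_3:
  fixes A :: "complex^3^3"
  shows "(A *v x) $ i = A $ i $ 1 * x $ 1 + A $ i $ 2 * x $ 2 + A $ i $ 3 * x $ 3"
  by (simp add: matrix_vector_mult_def sum_3)

text \<open>Lie's theorem is used twice: a weight vector \<open>w\<close> of the transpose has a
  kernel \<open>W\<close> that is invariant under \<open>L\<close>, and a second application inside
  \<open>W\<close> yields \<open>v\<close>.\<close>

lemma exists_weight_flag:
  fixes L :: "(complex^3^3) set"
  assumes L: "gl.lie_subalgebra L" "gl.solvable L"
  obtains v w where "weight_vector L v" "weight_vector (transpose ` L) w"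
    "w $ 1 * v $ 1 + w $ 2 * v $ 2 + w $ 3 * v $ 3 = 0"
proof -
  have "(UNIV :: (complex^3) set) \<noteq> {0}"
    using zero_neq_one[where 'a = "complex^3"] by blast
  then obtain w where w: "weight_vector (transpose ` L) w"
    using lie_theorem[OF lie_subalgebra_transpose[OF L(1)] solvable_transpose[OF L(2)], of UNIV] by auto
  define W where "W = {x :: complex^3. w $ 1 * x $ 1 + w $ 2 * x $ 2 + w $ 3 * x $ 3 = 0}"
  have W_iff: "x \<in> W \<longleftrightarrow> w $ 1 * x $ 1 + w $ 2 * x $ 2 + w $ 3 * x $ 3 = 0" for x
    by (simp add: W_def)
  have "vec.subspace W"
    unfolding vec.subspace_def
  proof (intro conjI ballI allI)
    show "x + y \<in> W" if "x \<in> W" "y \<in> W" for x y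
      using that by (simp add: W_iff) algebra
    show "c *s x \<in> W" if "x \<in> W" for x c
      using that by (simp add: W_iff) algebra
  qed (simp add: W_iff)
  moreover have "W \<noteq> {0}"
  proof -
    \<comment> \<open>Up to sign these are the cross products of \<open>w\<close> with the standard
      basis vectors; they vanish together only for \<open>w = 0\<close>.\<close>
    have "(vector [w $ 2, - w $ 1, 0] :: complex^3) \<in> W" "(vector [w $ 3, 0, - w $ 1] :: complex^3) \<in> W"
      "(vector [0, w $ 3, - w $ 2] :: complex^3) \<in> W"
      by (simp_all add: W_iff)
    moreover have "vector [w $ 2, - w $ 1, 0] \<noteq> (0 :: complex^3) \<or>
        vector [w $ 3, 0, - w $ 1] \<noteq> (0 :: complex^3) \<or> vector [0, w $ 3, - w $ 2] \<noteq> (0 :: complex^3)"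
      using w by (auto simp: weight_vector_def vec_eq_iff forall_3)
    ultimately show ?thesis by blast
  qed
  moreover have "A *v x \<in> W" if A: "A \<in> L" and x: "x \<in> W" for A x
  proof -
    obtain c where "transpose A *v w = c *s w" using w A by (auto simp: weight_vector_def)
    then have "A $ 1 $ i * w $ 1 + A $ 2 $ i * w $ 2 + A $ 3 $ i * w $ 3 = c * w $ i" for i
      using matrix_vector_entry_3[of "transpose A" w i] by (simp add: transpose_def)
    from this[of 1] this[of 2] this[of 3] x show ?thesis
      unfolding W_iff matrix_vector_entry_3 by algebra
  qed
  ultimately obtain v where "v \<in> W" "weight_vector L v"
    using lie_theorem[OF L] by blast
  with w that show ?thesis unfolding W_iff by blast
qed

text \<open>Up to scaling, the rows of \<open>g\<close> are the conjugate of \<open>v\<close>, the cross product of \<open>v\<close> with the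
  conjugate of \<open>w\<close>, and \<open>w\<close>; as \<open>w\<close> annihilates \<open>v\<close>, their determinant is
  \<open>- \<bar>v\<bar>\<^sup>2 \<bar>w\<bar>\<^sup>2\<close>.\<close>

lemma exists_adapted_matrix:
  fixes v w :: "complex^3"
  assumes "v \<noteq> 0" "w \<noteq> 0" "w $ 1 * v $ 1 + w $ 2 * v $ 2 + w $ 3 * v $ 3 = 0"
  obtains g :: "complex^3^3" where "det g = 1" "g $ 3 = w" "(g *v v) $ 1 \<noteq> 0" "(g *v v) $ 2 = 0" "(g *v v) $ 3 = 0"
proof -
  define N where "N x = cnj (x $ 1) * x $ 1 + cnj (x $ 2) * x $ 2 + cnj (x $ 3) * x $ 3" for x :: "complex^3"
  have N: "N x \<noteq> 0" if "x \<noteq> 0" for x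
  proof -
    have "N x = of_real ((cmod (x $ 1))\<^sup>2 + (cmod (x $ 2))\<^sup>2 + (cmod (x $ 3))\<^sup>2)"
      unfolding N_def by (simp only: of_real_add complex_norm_square mult.commute)
    moreover have "(cmod (x $ 1))\<^sup>2 + (cmod (x $ 2))\<^sup>2 + (cmod (x $ 3))\<^sup>2 \<noteq> 0"
      using that by (auto simp: vec_eq_iff forall_3 add_nonneg_eq_0_iff)
    ultimately show ?thesis by (metis of_real_eq_0_iff)
  qed
  define D where "D = - (N v * N w)"
  have D: "D \<noteq> 0" using N assms(1,2) by (simp add: D_def)
  define g :: "complex^3^3" where
    "g = vector [vector [cnj (v $ 1) / D, cnj (v $ 2) / D, cnj (v $ 3) / D],
       vector [v $ 2 * cnj (w $ 3) - v $ 3 * cnj (w $ 2),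
               v $ 3 * cnj (w $ 1) - v $ 1 * cnj (w $ 3),
               v $ 1 * cnj (w $ 2) - v $ 2 * cnj (w $ 1)], w]"
  show ?thesis
  proof (rule that)
    \<comment> \<open>Naming the conjugates turns the determinant into a polynomial identity: the
      expansion of the triple product of vectors, in which the term containing the pairing of
      \<open>w\<close> and \<open>v\<close> drops out.\<close>
    define a b where "a i = cnj (v $ i)" and "b i = cnj (w $ i)" for i
    have "D * det g = a 1 * ((v $ 3 * b 1 - v $ 1 * b 3) * w $ 3 - (v $ 1 * b 2 - v $ 2 * b 1) * w $ 2)
        - a 2 * ((v $ 2 * b 3 - v $ 3 * b 2) * w $ 3 - (v $ 1 * b 2 - v $ 2 * b 1) * w $ 1)
        + a 3 * ((v $ 2 * b 3 - v $ 3 * b 2) * w $ 2 - (v $ 3 * b 1 - v $ 1 * b 3) * w $ 1)"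
      using D by (simp add: det_3 g_def a_def[symmetric] b_def[symmetric] field_simps)
    also have "\<dots> = (a 1 * b 1 + a 2 * b 2 + a 3 * b 3) * (w $ 1 * v $ 1 + w $ 2 * v $ 2 + w $ 3 * v $ 3)
        - (a 1 * v $ 1 + a 2 * v $ 2 + a 3 * v $ 3) * (b 1 * w $ 1 + b 2 * w $ 2 + b 3 * w $ 3)"
      by algebra
    also have "\<dots> = D" using assms(3) by (simp add: D_def N_def a_def b_def)
    finally have "D * det g = D" .
    then show "det g = 1" using D by simp
    show "g $ 3 = w" by (simp add: g_def)
    have "(g *v v) $ 1 = N v / D"
      by (simp add: matrix_vector_entry_3 g_def N_def add_divide_distrib)
    then show "(g *v v) $ 1 \<noteq> 0" using D N assms(1) by simp
    show "(g *v v) $ 2 = 0" by (simp add: matrix_vector_entry_3 g_def) algebra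
    show "(g *v v) $ 3 = 0" using assms(3) by (simp add: matrix_vector_entry_3 g_def)
  qed
qed

definition borel_algebra :: "(complex^3^3) set" where
  "borel_algebra = {chevalley a b c d e 0 0 0 | a b c d e. True}"

lemma borel_algebra_iff: "A \<in> borel_algebra \<longleftrightarrow> A \<in> A2 \<and> A $ 2 $ 1 = 0 \<and> A $ 3 $ 1 = 0 \<and> A $ 3 $ 2 = 0"
proof
  assume "A \<in> borel_algebra"
  then obtain a b c d e where "A = chevalley a b c d e 0 0 0" unfolding borel_algebra_def by blast
  then show "A \<in> A2 \<and> A $ 2 $ 1 = 0 \<and> A $ 3 $ 1 = 0 \<and> A $ 3 $ 2 = 0"
    unfolding A2_eq_range by (intro conjI) (blast, simp_all)
next
  assume A: "A \<in> A2 \<and> A $ 2 $ 1 = 0 \<and> A $ 3 $ 1 = 0 \<and> A $ 3 $ 2 = 0"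
  then obtain a b c d e c' d' e' where "A = chevalley a b c d e c' d' e'" unfolding A2_eq_range by blast
  with A have "A = chevalley a b c d e 0 0 0" by simp
  then show "A \<in> borel_algebra" unfolding borel_algebra_def by blast
qed

text \<open>Since \<open>g\<close> sends \<open>v\<close> to a multiple of the first basis vector,
  that vector is an eigenvector of each conjugate, which clears the first column below the diagonal.
  Since \<open>w\<close> is the third row of \<open>g\<close>, the third row of each conjugate is a
  multiple of the third unit row.\<close>

lemma exists_conjugate_in_borel:
  assumes L: "A2_subalgebra L" "gl.solvable L"
  obtains g where "det g = 1" "(\<lambda>A. g ** A ** matrix_inv g) ` L \<subseteq> borel_algebra"
proof -
  obtain v w where vw: "weight_vector L v" "weight_vector (transpose ` L) w"
    "w $ 1 * v $ 1 + w $ 2 * v $ 2 + w $ 3 * v $ 3 = 0"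
    using exists_weight_flag L by (auto simp: A2_subalgebra_def)
  obtain g :: "complex^3^3" where g: "det g = 1" "g $ 3 = w" "(g *v v) $ 1 \<noteq> 0"
    "(g *v v) $ 2 = 0" "(g *v v) $ 3 = 0"
    using exists_adapted_matrix vw by (auto simp: weight_vector_def)
  have "(\<lambda>A. g ** A ** matrix_inv g) ` L \<subseteq> A2"
    using A2_subalgebra_conjugate(1)[OF g(1) L(1)] by (simp add: A2_subalgebra_def)
  moreover have "(g ** A ** matrix_inv g) $ 2 $ 1 = 0 \<and> (g ** A ** matrix_inv g) $ 3 $ 1 = 0 \<and>
      (g ** A ** matrix_inv g) $ 3 $ 2 = 0" if A: "A \<in> L" for A
  proof -
    define B where "B = g ** A ** matrix_inv g"
    have Bg: "B ** g = g ** A"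
      using conjugate_eq_iff[OF g(1), of A B] by (simp add: B_def)
    obtain c where c: "A *v v = c *s v" using vw(1) A by (auto simp: weight_vector_def)
    have "B *v (g *v v) = g *v (A *v v)"
      by (simp add: matrix_vector_mul_assoc Bg)
    also have "\<dots> = c *s (g *v v)" by (simp add: c vec.scale)
    finally have "(B *v (g *v v)) $ i = c * (g *v v) $ i" for i by simp
    from this[of 2] this[of 3] have 1: "B $ 2 $ 1 = 0" "B $ 3 $ 1 = 0"
      using g(3-5) by (simp_all add: matrix_vector_entry_3[of B])
    obtain d where "transpose A *v w = d *s w" using vw(2) A by (auto simp: weight_vector_def)
    then have d: "A $ 1 $ i * w $ 1 + A $ 2 $ i * w $ 2 + A $ 3 $ i * w $ 3 = d * w $ i" for i
      using matrix_vector_entry_3[of "transpose A" w i] by (simp add: transpose_def)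
    have "(g ** A) $ 3 $ i = d * g $ 3 $ i" for i
      using d[of i] by (simp add: matrix_mult_entry_3 g(2) mult.commute)
    then have "B $ 3 $ 2 = d * (g ** matrix_inv g) $ 3 $ 2"
      by (simp add: B_def matrix_mult_entry_3[of "g ** A"] matrix_mult_entry_3[of g "matrix_inv g"] algebra_simps)
    then have "B $ 3 $ 2 = 0" using matrix_inv_cancel(1)[OF g(1)] by (simp add: mat_def)
    with 1 show ?thesis by (simp add: B_def)
  qed
  ultimately show ?thesis by (intro that[OF g(1)] subsetI) (auto simp: borel_algebra_iff)
qed

section \<open>Four-dimensional subalgebras as hyperplanes of the Borel algebra\<close>

lemma isomorphic_toral_nil_1_0: "isomorphic_to (toral_nil 1 0) (M13 2)"
  using isomorphic_toral_nil_M13[of 1 0] by simp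

text \<open>Dimension five is obtained by adjoining one vector to a subalgebra whose dimension four
  is known from its isomorphism type.\<close>

lemma borel_algebra_span: "borel_algebra = gl.span (insert h2 (toral_nil 1 0))" "h2 \<notin> gl.span (toral_nil 1 0)"
proof -
  have sub: "gl.span (toral_nil 1 0) = toral_nil 1 0"
    using A2_subalgebra_toral_nil by (simp add: A2_subalgebra_def gl.lie_subalgebra_def)
  show "h2 \<notin> gl.span (toral_nil 1 0)"
    unfolding sub by (auto simp: toral_nil_def h2_def chevalley_eq_iff)
  show "borel_algebra = gl.span (insert h2 (toral_nil 1 0))"
  proof (intro equalityI subsetI)
    fix A assume "A \<in> borel_algebra"
    then obtain a b c d e where "A = chevalley a b c d e 0 0 0" unfolding borel_algebra_def by blast
    then have "A - mscale b h2 \<in> toral_nil 1 0"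
      using toral_nil_member[of a 1 0 c d e] by (simp add: h2_def chevalley_scale chevalley_diff)
    then show "A \<in> gl.span (insert h2 (toral_nil 1 0))" unfolding gl.span_insert sub by blast
  next
    fix A assume "A \<in> gl.span (insert h2 (toral_nil 1 0))"
    then obtain k s c d e where "A - mscale k h2 = chevalley s 0 c d e 0 0 0"
      unfolding gl.span_insert sub by (auto simp: toral_nil_def)
    then have "A = chevalley s k c d e 0 0 0"
      unfolding diff_eq_eq by (simp add: h2_def chevalley_scale chevalley_add)
    then show "A \<in> borel_algebra" unfolding borel_algebra_def by blast
  qed
qed

lemma dim_borel_algebra: "gl.dim borel_algebra = 5"
  unfolding borel_algebra_span(1) gl.dim_span gl.dim_insert
  using borel_algebra_span(2) dim_isomorphic_to[OF isomorphic_toral_nil_1_0] by simp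

text \<open>Any \<open>B\<close> of the Borel algebra outside \<open>L\<close> spans it together
  with \<open>L\<close>. The coefficients \<open>p\<close> to \<open>t\<close> are the components
  along \<open>B\<close> of the basis elements \<open>h1\<close>, \<open>h2\<close>,
  \<open>x1\<close>, \<open>x2\<close>, \<open>x3\<close>, so the functional reads off the component
  of a matrix along \<open>B\<close>.\<close>

lemma borel_hyperplane:
  assumes L: "A2_subalgebra L" "L \<subseteq> borel_algebra" "gl.dim L = 4"
  obtains p q r s t where "p \<noteq> 0 \<or> q \<noteq> 0 \<or> r \<noteq> 0 \<or> s \<noteq> 0 \<or> t \<noteq> 0"
    "\<And>a b c d e. chevalley a b c d e 0 0 0 \<in> L \<longleftrightarrow> p * a + q * b + r * c + s * d + t * e = 0"
proof -
  note D = A2_subalgebraD[OF L(1)]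
  have sub: "gl.subspace L" using L(1) by (simp add: A2_subalgebra_def gl.lie_subalgebra_def)
  have "L \<noteq> borel_algebra" using L(3) dim_borel_algebra by auto
  then obtain B where B: "B \<in> borel_algebra" "B \<notin> L" using L(2) by blast
  have "gl.dim (insert B L) = 5" using B(2) L(3) sub by (simp add: gl.dim_insert gl.span_eq_iff[THEN iffD2])
  then have "gl.span (insert B L) = gl.span borel_algebra"
    using L(2) B(1) dim_borel_algebra by (intro gl.dim_eq_span) auto
  then have ex: "\<exists>k. A - mscale k B \<in> L" if "A \<in> borel_algebra" for A
    using gl.span_base[OF that] sub by (metis gl.span_breakdown_eq gl.span_eq_iff)
  have borel: "chevalley a b c d e 0 0 0 \<in> borel_algebra" for a b c d e
    unfolding borel_algebra_def by blast
  obtain p q r s t where p: "h1 - mscale p B \<in> L" and q: "h2 - mscale q B \<in> L"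
    and r: "x1 - mscale r B \<in> L" and s: "x2 - mscale s B \<in> L" and t: "x3 - mscale t B \<in> L"
    using ex borel unfolding xyh_defs by metis
  have iff: "chevalley a b c d e 0 0 0 \<in> L \<longleftrightarrow> p * a + q * b + r * c + s * d + t * e = 0" for a b c d e
  proof -
    define f where "f = p * a + q * b + r * c + s * d + t * e"
    define E where "E = mscale a (h1 - mscale p B) + mscale b (h2 - mscale q B) + mscale c (x1 - mscale r B)
        + mscale d (x2 - mscale s B) + mscale e (x3 - mscale t B)"
    have E: "E \<in> L" unfolding E_def by (intro D(2,3) p q r s t)
    have eq: "chevalley a b c d e 0 0 0 = E + mscale f B"
      unfolding chevalley_expand[of a b c d e] E_def f_def
      by (simp add: mscale_def vec_eq_iff algebra_simps)
    have "f = 0" if "E + mscale f B \<in> L"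
    proof (rule ccontr)
      assume f: "f \<noteq> 0"
      have "mscale f B \<in> L" using gl.subspace_diff[OF sub that E] by simp
      then have "mscale (inverse f) (mscale f B) \<in> L" by (rule D(3))
      then show False using f B(2) by simp
    qed
    moreover have "E + mscale f B \<in> L" if "f = 0" using that E by simp
    ultimately show ?thesis unfolding eq f_def[symmetric] by blast
  qed
  moreover have "p \<noteq> 0 \<or> q \<noteq> 0 \<or> r \<noteq> 0 \<or> s \<noteq> 0 \<or> t \<noteq> 0"
    using B iff unfolding borel_algebra_def by force
  ultimately show ?thesis using that by blast
qed

section \<open>Equivalence of the subalgebras\<close>

lemma equivalent_sym:
  assumes "equivalent L L'"
  shows "equivalent L' L"
proof -
  obtain g where g: "det g = 1" "\<forall>A\<in>L. \<exists>B\<in>L'. g ** A = B ** g" "\<forall>B\<in>L'. \<exists>A\<in>L. g ** A = B ** g"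
    using assms unfolding equivalent_iff by blast
  have "det (matrix_inv g) = 1"
    using matrix_inv_cancel(1)[OF g(1)] g(1) by (metis det_I det_mul mult_1)
  moreover have "matrix_inv g ** B = A ** matrix_inv g" if "g ** A = B ** g" for A B
  proof -
    have "B = g ** A ** matrix_inv g" using conjugate_eq_iff[OF g(1), of A B] that by simp
    then show ?thesis
      by (simp add: matrix_mul_assoc matrix_inv_cancel(2)[OF g(1)])
  qed
  ultimately show ?thesis using g(2,3) unfolding equivalent_iff by blast
qed

section \<open>Inequivalence of the listed subalgebras\<close>

lemma intertwined_cube_zero:
  fixes A B g :: "complex^'n^'n"
  assumes "det g = 1" "g ** A = B ** g" "A ** A ** A = 0"
  shows "B ** B ** B = 0"
proof -
  have "(B ** B ** B) ** g = g ** (A ** A ** A)"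
    using assms(2) by (metis matrix_mul_assoc)
  then have "(B ** B ** B) ** (g ** matrix_inv g) = 0"
    by (simp add: assms(3) matrix_mul_assoc)
  then show ?thesis by (simp add: matrix_inv_cancel(1)[OF assms(1)])
qed

lemma intertwined_square_zero:
  fixes A B g :: "complex^'n^'n"
  assumes "det g = 1" "g ** A = B ** g" "B ** B = 0"
  shows "A ** A = 0"
proof -
  have "g ** (A ** A) = (B ** B) ** g"
    using assms(2) by (metis matrix_mul_assoc)
  then have "(matrix_inv g ** g) ** (A ** A) = 0"
    by (simp add: assms(3) matrix_mul_assoc[symmetric])
  then show ?thesis by (simp add: matrix_inv_cancel(2)[OF assms(1)])
qed

text \<open>The matrices are triangular, so the diagonal of the cube consists of the cubes of the
  diagonal entries and a vanishing cube kills the toral part.\<close>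

lemma cube_zero_alg8_1:
  assumes "A \<in> alg8_1" "A ** A ** A = 0"
  obtains c e where "A = chevalley 0 0 c 0 e 0 0 0"
proof -
  obtain a b c e where A: "A = chevalley a b c 0 e 0 0 0" using assms(1) unfolding alg8_1_def by blast
  have "(A ** A ** A) $ 1 $ 1 = a * a * a" "(A ** A ** A) $ 3 $ 3 = - (b * b * b)"
    by (simp_all add: A matrix_mult_entry_3)
  with assms(2) A that show ?thesis by simp
qed

lemma cube_zero_alg8_2:
  assumes "A \<in> alg8_2" "A ** A ** A = 0"
  obtains c d where "A = chevalley 0 0 c 0 0 0 d 0"
proof -
  obtain a b c d where A: "A = chevalley a b c 0 0 0 d 0" using assms(1) unfolding alg8_2_def by blast
  have "(A ** A ** A) $ 1 $ 1 = a * a * a" "(A ** A ** A) $ 3 $ 3 = - (b * b * b)"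
    by (simp_all add: A matrix_mult_entry_3)
  with assms(2) A that show ?thesis by simp
qed

lemma cube_zero_toral_nil:
  assumes "A \<in> toral_nil p q" "A ** A ** A = 0"
  obtains c d e where "A = chevalley 0 0 c d e 0 0 0"
proof -
  obtain s c d e where A: "A = chevalley (s * p) (s * q) c d e 0 0 0" using assms(1) unfolding toral_nil_def by blast
  have "(A ** A ** A) $ 1 $ 1 = (s * p) * (s * p) * (s * p)"
      "(A ** A ** A) $ 3 $ 3 = - ((s * q) * (s * q) * (s * q))"
    by (simp_all add: A matrix_mult_entry_3)
  then have "s * p = 0" "s * q = 0" using assms(2) by auto
  with A that show ?thesis by simp
qed

lemma toral_nil_not_equivalent:
  assumes L: "\<And>A. A \<in> L \<Longrightarrow> A ** A ** A = 0 \<Longrightarrow> A ** A = 0"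
  shows "\<not> equivalent (toral_nil p q) L"
proof
  assume "equivalent (toral_nil p q) L"
  then obtain g where g: "det g = 1" "\<forall>A\<in>toral_nil p q. \<exists>B\<in>L. g ** A = B ** g"
    unfolding equivalent_iff by blast
  \<comment> \<open>\<open>x1 + x2\<close> is a single Jordan block of size three.\<close>
  define A where "A = chevalley 0 0 1 1 0 0 0 0"
  have "A \<in> toral_nil p q" using toral_nil_member[of 0 p q] by (simp add: A_def)
  then obtain B where B: "B \<in> L" "g ** A = B ** g" using g(2) by blast
  have "A ** A ** A = 0" by (simp add: matrix_eq_iff_3 matrix_mult_entry_3 A_def)
  then have "B ** B = 0" using L B intertwined_cube_zero[OF g(1) B(2)] by blast
  then have "A ** A = 0" using intertwined_square_zero[OF g(1) B(2)] by blast
  then have "(A ** A) $ 1 $ 3 = 0" by simp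
  then show False by (simp add: matrix_mult_entry_3 A_def)
qed

lemma toral_nil_not_equivalent_alg8_1: "\<not> equivalent (toral_nil p q) alg8_1"
  by (rule toral_nil_not_equivalent, erule cube_zero_alg8_1) (auto simp: matrix_eq_iff_3 matrix_mult_entry_3)

lemma toral_nil_not_equivalent_alg8_2: "\<not> equivalent (toral_nil p q) alg8_2"
  by (rule toral_nil_not_equivalent, erule cube_zero_alg8_2) (auto simp: matrix_eq_iff_3 matrix_mult_entry_3)

text \<open>All nilpotent elements of \<open>alg8_1\<close> have image in one line, whereas those of
  \<open>alg8_2\<close> annihilate a common plane. In entries, a matrix intertwining
  \<open>x1\<close> and \<open>x3\<close> with nilpotent elements of \<open>alg8_2\<close> has a
  zero first column.\<close>

lemma alg8_1_not_equivalent_alg8_2: "\<not> equivalent alg8_1 alg8_2"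
proof
  assume "equivalent alg8_1 alg8_2"
  then obtain g where g: "det g = 1" "\<forall>A\<in>alg8_1. \<exists>B\<in>alg8_2. g ** A = B ** g"
    unfolding equivalent_iff by blast
  have image: "\<exists>c d. g ** chevalley 0 0 a 0 b 0 0 0 = chevalley 0 0 c 0 0 0 d 0 ** g" for a b
  proof -
    define A where "A = chevalley 0 0 a 0 b 0 0 0"
    have "A \<in> alg8_1" unfolding A_def alg8_1_def by blast
    then obtain B where B: "B \<in> alg8_2" "g ** A = B ** g" using g(2) by blast
    have "A ** A ** A = 0" by (simp add: matrix_eq_iff_3 matrix_mult_entry_3 A_def)
    from cube_zero_alg8_2[OF B(1) intertwined_cube_zero[OF g(1) B(2) this]] B(2)
    show ?thesis by (metis A_def)
  qed
  obtain c d where 1: "g ** chevalley 0 0 1 0 0 0 0 0 = chevalley 0 0 c 0 0 0 d 0 ** g"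
    using image[of 1 0] by blast
  obtain c' d' where 2: "g ** chevalley 0 0 0 0 1 0 0 0 = chevalley 0 0 c' 0 0 0 d' 0 ** g"
    using image[of 0 1] by blast
  have e1: "g $ 2 $ 1 = 0" "g $ 1 $ 1 = c * g $ 2 $ 2" "g $ 3 $ 1 = d * g $ 2 $ 2"
      "c * g $ 2 $ 3 = 0" "d * g $ 2 $ 3 = 0"
    using 1 by (simp_all add: matrix_eq_iff_3 matrix_mult_entry_3)
  have e2: "- g $ 1 $ 1 = c' * g $ 2 $ 3" "- g $ 3 $ 1 = d' * g $ 2 $ 3"
      "c' * g $ 2 $ 2 = 0" "d' * g $ 2 $ 2 = 0"
    using 2 by (simp_all add: matrix_eq_iff_3 matrix_mult_entry_3)
  have "g $ 1 $ 1 = 0 \<and> g $ 3 $ 1 = 0"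
  proof (cases "g $ 2 $ 2 = 0")
    case False
    with e2(3,4) have "c' = 0" "d' = 0" by auto
    with e2(1,2) show ?thesis by simp
  qed (use e1(2,3) in simp)
  with e1(1) have "det g = 0" by (simp add: det_3)
  with g(1) show False by simp
qed

lemma equivalent_toral_nil_imp_proportional:
  assumes eq: "equivalent (toral_nil p q) (toral_nil p' q')" and nz: "p' \<noteq> 0 \<or> q' \<noteq> 0"
  shows "p * q' = p' * q"
proof -
  obtain g where g: "det g = 1" "\<forall>A\<in>toral_nil p q. \<exists>B\<in>toral_nil p' q'. g ** A = B ** g"
    using eq unfolding equivalent_iff by blast
  have image: "\<exists>c d e. g ** chevalley 0 0 a b 0 0 0 0 = chevalley 0 0 c d e 0 0 0 ** g" for a b
  proof -
    define A where "A = chevalley 0 0 a b 0 0 0 0"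
    have "A \<in> toral_nil p q" using toral_nil_member[of 0 p q] by (simp add: A_def)
    then obtain B where B: "B \<in> toral_nil p' q'" "g ** A = B ** g" using g(2) by blast
    have "A ** A ** A = 0" by (simp add: matrix_eq_iff_3 matrix_mult_entry_3 A_def)
    from cube_zero_toral_nil[OF B(1) intertwined_cube_zero[OF g(1) B(2) this]] B(2)
    show ?thesis by (metis A_def)
  qed
  obtain c d e where 1: "g ** chevalley 0 0 1 0 0 0 0 0 = chevalley 0 0 c d e 0 0 0 ** g"
    using image[of 1 0] by blast
  obtain c' d' e' where 2: "g ** chevalley 0 0 0 1 0 0 0 0 = chevalley 0 0 c' d' e' 0 0 0 ** g"
    using image[of 0 1] by blast
  \<comment> \<open>The third row of a strictly upper triangular matrix is zero, so the third rows
    of both left-hand sides vanish.\<close>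
  have low: "g $ 3 $ 1 = 0" "g $ 3 $ 2 = 0"
    using 1 2 by (simp_all add: matrix_eq_iff_3 matrix_mult_entry_3)
  then have g33: "g $ 3 $ 3 \<noteq> 0" using g(1) by (auto simp: det_3)
  have "d * g $ 3 $ 3 = 0" "g $ 2 $ 1 = d * g $ 3 $ 2"
    using 1 by (simp_all add: matrix_eq_iff_3 matrix_mult_entry_3)
  then have g21: "g $ 2 $ 1 = 0" using low by simp
  have diag: "g $ 1 $ 1 \<noteq> 0" "g $ 2 $ 2 \<noteq> 0" using g(1) low g21 by (auto simp: det_3)
  have "chevalley p q 0 0 0 0 0 0 \<in> toral_nil p q" using toral_nil_member[of 1 p q] by simp
  then obtain s x y z where "g ** chevalley p q 0 0 0 0 0 0 = chevalley (s * p') (s * q') x y z 0 0 0 ** g"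
    using g(2) unfolding toral_nil_def by blast
  \<comment> \<open>For upper triangular factors the diagonal of a product is the product of the
    diagonals, so the nonzero diagonal entries of \<open>g\<close> cancel.\<close>
  then have "g $ 1 $ 1 * p = s * p' * g $ 1 $ 1" "g $ 3 $ 3 * q = s * q' * g $ 3 $ 3"
    using low g21 by (simp_all add: matrix_eq_iff_3 matrix_mult_entry_3)
  then have "p = s * p'" "q = s * q'" using diag g33 by simp_all
  then show ?thesis by simp
qed

section \<open>Solvability of the listed subalgebras\<close>

lemma derived_subsetI:
  assumes "gl.subspace T" "\<And>A B. A \<in> S \<Longrightarrow> B \<in> S \<Longrightarrow> commutator A B \<in> T"
  shows "gl.derived S \<subseteq> T"
  unfolding gl.derived_def using assms by (intro gl.span_minimal) auto

lemma derived_mono: "S \<subseteq> T \<Longrightarrow> gl.derived S \<subseteq> gl.derived T"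
  unfolding gl.derived_def by (intro gl.span_mono) auto

text \<open>With at least one derivation the set is a span and contains 0, so an inclusion is
  enough.\<close>

lemma solvableI:
  assumes "(gl.derived ^^ Suc n) S \<subseteq> {0}"
  shows "gl.solvable S"
proof -
  have "0 \<in> (gl.derived ^^ Suc n) S" by (simp add: gl.derived_def gl.span_zero)
  with assms have "(gl.derived ^^ Suc n) S = {0}" by blast
  then show ?thesis unfolding gl.solvable_def by blast
qed

lemma subspace_zero: "gl.subspace {0}"
  by (simp add: gl.subspace_def)

text \<open>Three derivations suffice: they lead to strictly upper triangular matrices, then to the
  corner entry, then to zero.\<close>

lemma solvable_borel_algebra:
  assumes "S \<subseteq> borel_algebra"
  shows "gl.solvable S"
proof -
  let ?N = "{chevalley 0 0 c d e 0 0 0 | c d e. True}"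
  let ?Z = "{chevalley 0 0 0 0 e 0 0 0 | e. True}"
  have N: "gl.subspace ?N"
    by (auto simp: gl.subspace_def chevalley_add chevalley_scale chevalley_zero[symmetric] chevalley_eq_iff)
  have Z: "gl.subspace ?Z"
    by (auto simp: gl.subspace_def chevalley_add chevalley_scale chevalley_zero[symmetric] chevalley_eq_iff)
  have "gl.derived S \<subseteq> ?N"
  proof (rule derived_subsetI[OF N])
    fix A B assume "A \<in> S" "B \<in> S"
    with assms have "A \<in> borel_algebra" "B \<in> borel_algebra" by auto
    then show "commutator A B \<in> ?N"
      by (auto simp: borel_algebra_def chevalley_commutator chevalley_eq_iff)
  qed
  then have "gl.derived (gl.derived S) \<subseteq> gl.derived ?N" by (rule derived_mono)
  also have "\<dots> \<subseteq> ?Z" by (intro derived_subsetI[OF Z]) (auto simp: chevalley_commutator)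
  finally have "gl.derived (gl.derived (gl.derived S)) \<subseteq> gl.derived ?Z" by (rule derived_mono)
  also have "\<dots> \<subseteq> {0}"
    by (intro derived_subsetI[OF subspace_zero]) (auto simp: chevalley_commutator chevalley_zero)
  finally show ?thesis using solvableI[of 2 S] by (simp add: numeral_2_eq_2)
qed

text \<open>As \<open>y2\<close> lies below the diagonal, this algebra is treated separately;
  \<open>x1\<close> and \<open>y2\<close> commute, so two derivations suffice.\<close>

lemma solvable_alg8_2: "gl.solvable alg8_2"
proof -
  let ?N = "{chevalley 0 0 c 0 0 0 d 0 | c d. True}"
  have N: "gl.subspace ?N"
    by (auto simp: gl.subspace_def chevalley_add chevalley_scale chevalley_zero[symmetric] chevalley_eq_iff)
  have "gl.derived alg8_2 \<subseteq> ?N"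
    by (intro derived_subsetI[OF N]) (auto simp: alg8_2_def chevalley_commutator chevalley_eq_iff)
  then have "gl.derived (gl.derived alg8_2) \<subseteq> gl.derived ?N" by (rule derived_mono)
  also have "\<dots> \<subseteq> {0}"
    by (intro derived_subsetI[OF subspace_zero]) (auto simp: chevalley_commutator chevalley_zero)
  finally show ?thesis using solvableI[of 1 alg8_2] by simp
qed

section \<open>Normal forms inside the Borel algebra\<close>

lemma toral_nil_subset_borel: "toral_nil p q \<subseteq> borel_algebra"
  unfolding toral_nil_def borel_algebra_def by blast

lemma alg8_1_subset_borel: "alg8_1 \<subseteq> borel_algebra"
  unfolding alg8_1_def borel_algebra_def by blast

text \<open>The matrix is a shear followed by a signed exchange of the last two coordinates. The
  shear removes the \<open>x1\<close> component tied to the torus; the exchange turns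
  \<open>x2\<close> and \<open>x3\<close> into \<open>y2\<close> and \<open>x1\<close> up to
  sign.\<close>

lemma equivalent_alg8_2:
  assumes L: "L = {chevalley a b (Q * (2 * a - b)) d e 0 0 0 | a b d e. True}"
  shows "equivalent L alg8_2"
  unfolding equivalent_iff
proof (intro exI conjI ballI)
  let ?g = "vector [vector [1, Q, 0], vector [0, 0, 1], vector [0, - 1, 0]] :: complex^3^3"
  show "det ?g = 1" by (simp add: det_3)
  have eq: "?g ** chevalley a b (Q * (2 * a - b)) d e 0 0 0 =
      chevalley a (a - b) (Q * d - e) 0 0 0 (- d) 0 ** ?g" for a b d e
    by (simp add: matrix_eq_iff_3 matrix_mult_entry_3 algebra_simps)
  show "\<exists>B\<in>alg8_2. ?g ** A = B ** ?g" if "A \<in> L" for A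
    using that eq unfolding L alg8_2_def by blast
  show "\<exists>A\<in>L. ?g ** A = B ** ?g" if B: "B \<in> alg8_2" for B
  proof -
    obtain a b c d where "B = chevalley a b c 0 0 0 d 0" using B unfolding alg8_2_def by blast
    then have "?g ** chevalley a (a - b) (Q * (2 * a - (a - b))) (- d) (- Q * d - c) 0 0 0 = B ** ?g"
      using eq[of a "a - b" "- d" "- Q * d - c"] by simp
    then show ?thesis unfolding L by blast
  qed
qed

text \<open>A shear removes the \<open>x2\<close> component tied to the torus and only shifts the
  coefficient of \<open>x3\<close>.\<close>

lemma equivalent_alg8_1:
  assumes L: "L = {chevalley a b c (P * (2 * b - a)) e 0 0 0 | a b c e. True}"
  shows "equivalent L alg8_1"
  unfolding equivalent_iff
proof (intro exI conjI ballI)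
  let ?g = "vector [vector [1, 0, 0], vector [0, 1, P], vector [0, 0, 1]] :: complex^3^3"
  show "det ?g = 1" by (simp add: det_3)
  have eq: "?g ** chevalley a b c (P * (2 * b - a)) e 0 0 0 =
      chevalley a b c 0 (e + P * c) 0 0 0 ** ?g" for a b c e
    by (simp add: matrix_eq_iff_3 matrix_mult_entry_3 algebra_simps)
  show "\<exists>B\<in>alg8_1. ?g ** A = B ** ?g" if "A \<in> L" for A
    using that eq unfolding L alg8_1_def by blast
  show "\<exists>A\<in>L. ?g ** A = B ** ?g" if B: "B \<in> alg8_1" for B
  proof -
    obtain a b c e where "B = chevalley a b c 0 e 0 0 0" using B unfolding alg8_1_def by blast
    then have "?g ** chevalley a b c (P * (2 * b - a)) (e - P * c) 0 0 0 = B ** ?g"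
      using eq[of a b c "e - P * c"] by simp
    then show ?thesis unfolding L by blast
  qed
qed

lemma borel_subset_eqI:
  assumes "L \<subseteq> borel_algebra" "M \<subseteq> borel_algebra"
    "\<And>a b c d e. chevalley a b c d e 0 0 0 \<in> L \<longleftrightarrow> chevalley a b c d e 0 0 0 \<in> M"
  shows "L = M"
proof -
  have "A \<in> L \<longleftrightarrow> A \<in> M" if "A \<in> borel_algebra" for A
    using that assms(3) unfolding borel_algebra_def by blast
  with assms(1,2) show ?thesis by blast
qed

text \<open>Brackets of suitable elements of the kernel give polynomial equations for the
  coefficients of the defining functional.\<close>

lemma borel_subalgebra_classification:
  assumes L: "A2_subalgebra L" "L \<subseteq> borel_algebra" "gl.dim L = 4"
  shows "equivalent L alg8_1 \<or> equivalent L alg8_2 \<or> (\<exists>p q. (p \<noteq> 0 \<or> q \<noteq> 0) \<and> L = toral_nil p q)"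
proof -
  obtain p q r s t where nz: "p \<noteq> 0 \<or> q \<noteq> 0 \<or> r \<noteq> 0 \<or> s \<noteq> 0 \<or> t \<noteq> 0"
    and mem: "\<And>a b c d e. chevalley a b c d e 0 0 0 \<in> L \<longleftrightarrow> p * a + q * b + r * c + s * d + t * e = 0"
    using borel_hyperplane[OF L] by blast
  have closed: "p * 0 + q * 0 + r * ((2 * a - b) * c' - (2 * a' - b') * c) + s * ((2 * b - a) * d' - (2 * b' - a') * d)
      + t * ((a + b) * e' - (a' + b') * e - c * d' + d * c') = 0"
    if "p * a + q * b + r * c + s * d + t * e = 0" "p * a' + q * b' + r * c' + s * d' + t * e' = 0"
    for a b c d e a' b' c' d' e'
  proof -
    have "commutator (chevalley a b c d e 0 0 0) (chevalley a' b' c' d' e' 0 0 0) \<in> L"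
      using that by (intro A2_subalgebraD(4)[OF L(1)]) (simp_all add: mem)
    then show ?thesis by (simp add: chevalley_commutator mem)
  qed
  \<comment> \<open>The bracket of \<open>t x1 - r x3\<close> and \<open>t x2 - s x3\<close> is
    \<open>- t * t\<close> times \<open>x3\<close>, so the cube of \<open>t\<close>
    vanishes.\<close>
  have t: "t = 0"
    using closed[of 0 0 t 0 "- r" 0 0 0 t "- s"] by (simp add: mult.commute)
  consider "r = 0" "s = 0" | "r \<noteq> 0" | "s \<noteq> 0" by blast
  then show ?thesis
  proof cases
    case 1
    \<comment> \<open>The functional now depends on the toral coordinates alone, and its kernel
      there is the line through \<open>(q, - p)\<close>.\<close>
    have "L = toral_nil q (- p)"
    proof (rule borel_subset_eqI[OF L(2) toral_nil_subset_borel])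
      fix a b c d e
      have "chevalley a b c d e 0 0 0 \<in> toral_nil q (- p) \<longleftrightarrow> (\<exists>k. a = k * q \<and> b = - (k * p))"
        unfolding toral_nil_def by (auto simp: chevalley_eq_iff)
      also have "\<dots> \<longleftrightarrow> p * a + q * b = 0"
      proof
        assume pq: "p * a + q * b = 0"
        show "\<exists>k. a = k * q \<and> b = - (k * p)"
        proof (cases "q = 0")
          case True
          then have "p \<noteq> 0" using nz 1 t by simp
          with pq True show ?thesis by (intro exI[of _ "- b / p"]) simp
        next
          case False
          moreover have "b = - (a / q * p)"
            using pq False by (simp add: field_simps eq_neg_iff_add_eq_0)
          ultimately show ?thesis by (intro exI[of _ "a / q"]) simp
        qed
      qed auto
      finally show "chevalley a b c d e 0 0 0 \<in> L \<longleftrightarrow> chevalley a b c d e 0 0 0 \<in> toral_nil q (- p)"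
        by (simp add: mem 1 t)
    qed
    moreover have "q \<noteq> 0 \<or> - p \<noteq> 0" using nz 1 t by auto
    ultimately show ?thesis by blast
  next
    case 2
    \<comment> \<open>From the bracket of \<open>r h1 - p x1\<close> and
      \<open>s x1 - r x2\<close>.\<close>
    have "r * (r * s * 3) = 0"
      using closed[of r 0 "- p" 0 0 0 0 s "- r" 0] by (simp add: t algebra_simps)
    then have s: "s = 0" using 2 by simp
    \<comment> \<open>From the bracket of \<open>r h1 - p x1\<close> and \<open>r h2 - q x1\<close>.
      The resulting relation makes the toral part of the functional a multiple of the root
      \<open>2 * a - b\<close> of \<open>x1\<close>, which is what a shear can remove.\<close>
    have "r * ((2 * r - 0) * (- q) - (2 * 0 - r) * (- p)) = 0"
      using closed[of r 0 "- p" 0 0 0 r "- q" 0 0] by (simp add: t s mult.commute)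
    then have "r * (r * (p + 2 * q)) = 0" by algebra
    then have p: "p = - 2 * q" using 2 by (simp add: eq_neg_iff_add_eq_0)
    define Q where "Q = q / r"
    have q: "q = Q * r" using 2 by (simp add: Q_def)
    have "L = {chevalley a b (Q * (2 * a - b)) d e 0 0 0 | a b d e. True}" (is "L = ?M")
    proof (rule borel_subset_eqI[OF L(2)])
      fix a b c d e
      have "p * a + q * b + r * c = r * (c - Q * (2 * a - b))"
        unfolding p q by algebra
      then show "chevalley a b c d e 0 0 0 \<in> L \<longleftrightarrow> chevalley a b c d e 0 0 0 \<in> ?M"
        using 2 by (auto simp: mem s t chevalley_eq_iff)
    qed (unfold borel_algebra_def, blast)
    then show ?thesis using equivalent_alg8_2 by blast
  next
    case 3
    \<comment> \<open>Mirror image of the previous case, first with \<open>s h2 - q x2\<close> and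
      \<open>s x1 - r x2\<close>, then with \<open>s h1 - p x2\<close> and
      \<open>s h2 - q x2\<close>; the root is now that of \<open>x2\<close>.\<close>
    have "r * (- s * s) + s * (2 * s * (- r)) = 0"
      using closed[of 0 s 0 "- q" 0 0 0 s "- r" 0] by (simp add: t mult.commute)
    then have "3 * (s * (s * r)) = 0" by algebra
    then have r: "r = 0" using 3 by simp
    have "s * ((2 * 0 - s) * (- q) - (2 * s - 0) * (- p)) = 0"
      using closed[of s 0 0 "- p" 0 0 s 0 "- q" 0] by (simp add: t r mult.commute)
    then have "s * (s * (2 * p + q)) = 0" by algebra
    then have q: "q = - 2 * p" using 3 by (simp add: eq_neg_iff_add_eq_0 add.commute)
    define P where "P = p / s"
    have p: "p = P * s" using 3 by (simp add: P_def)
    have "L = {chevalley a b c (P * (2 * b - a)) e 0 0 0 | a b c e. True}" (is "L = ?M")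
    proof (rule borel_subset_eqI[OF L(2)])
      fix a b c d e
      have "p * a + q * b + s * d = s * (d - P * (2 * b - a))"
        unfolding q p by algebra
      then show "chevalley a b c d e 0 0 0 \<in> L \<longleftrightarrow> chevalley a b c d e 0 0 0 \<in> ?M"
        using 3 by (auto simp: mem r t chevalley_eq_iff)
    qed (unfold borel_algebra_def, blast)
    then show ?thesis using equivalent_alg8_1 by blast
  qed
qed

section \<open>Assembling the classification\<close>

lemma labels_cases:
  assumes "l \<in> labels"
  obtains "l = L8_1" | "l = L8_2" | "l = L12_1" | \<alpha> where "l = L13_1 \<alpha>" "\<alpha> \<noteq> 1" "\<alpha> \<noteq> -1" | "l = L13_2" | "l = L14_1"
  using assms unfolding labels_def by auto

text \<open>The ratio of \<open>p\<close> to \<open>q\<close> determines the label: infinity gives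
  \<open>L13_2\<close>, 1 gives \<open>L12_1\<close>, -1 gives \<open>L14_1\<close>, and any other
  value \<open>\<alpha>\<close> gives \<open>L13_1 \<alpha>\<close>.\<close>

lemma toral_nil_label:
  assumes "p \<noteq> 0 \<or> q \<noteq> 0"
  shows "\<exists>l\<in>labels. subalg l = toral_nil p q"
proof (cases "q = 0")
  case True
  then have "subalg L13_2 = toral_nil p q" using toral_nil_scale[of p 1 0] assms by (simp add: subalg_L13_2 del: subalg.simps)
  then show ?thesis unfolding labels_def by blast
next
  case False
  define \<alpha> where "\<alpha> = p / q"
  have eq: "toral_nil p q = toral_nil \<alpha> 1" using toral_nil_scale[of q \<alpha> 1] False by (simp add: \<alpha>_def)
  consider "\<alpha> = 1" | "\<alpha> = -1" | "\<alpha> \<noteq> 1" "\<alpha> \<noteq> -1" by blast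
  then show ?thesis
  proof cases
    case 1
    then show ?thesis using eq subalg_L12 unfolding labels_def by blast
  next
    case 2
    then have "toral_nil p q = toral_nil 1 (-1)" using eq toral_nil_scale[of "-1" 1 "-1"] by simp
    then show ?thesis using subalg_L14 unfolding labels_def by blast
  next
    case 3
    then show ?thesis using eq subalg_L13[of \<alpha>] unfolding labels_def by blast
  qed
qed

lemmas subalg_eqs = subalg_L8_1 subalg_L8_2 subalg_L12 subalg_L13 subalg_L13_2 subalg_L14

theorem theorem6p8:
  shows "(\<forall>l\<in>labels. A2_subalgebra (subalg l) \<and> gl.solvable (subalg l) \<and> gl.dim (subalg l) = 4) \<and>
    isomorphic_to (subalg L8_1) M8 \<and>
    isomorphic_to (subalg L8_2) M8 \<and>
    isomorphic_to (subalg L12_1) M12 \<and>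
    (\<forall>\<alpha>::complex. \<alpha> \<noteq> 1 \<and> \<alpha> \<noteq> -1 \<longrightarrow>
           isomorphic_to (subalg (L13_1 \<alpha>)) (M13 ((2 * \<alpha> - 1) * (\<alpha> - 2) / (\<alpha> + 1)\<^sup>2))) \<and>
    isomorphic_to (subalg L13_2) (M13 2) \<and>
    isomorphic_to (subalg L14_1) M14 \<and>
    (\<forall>L. A2_subalgebra L \<and> gl.solvable L \<and> gl.dim L = 4 \<longrightarrow>
           (\<exists>l\<in>labels. equivalent L (subalg l))) \<and>
    (\<forall>l\<in>labels. \<forall>l'\<in>labels. l \<noteq> l' \<longrightarrow> \<not> equivalent (subalg l) (subalg l')) \<and>
    (\<forall>\<alpha> \<beta> :: complex. \<alpha> \<noteq> 1 \<and> \<alpha> \<noteq> -1 \<and> \<beta> \<noteq> 1 \<and> \<beta> \<noteq> -1 \<longrightarrow>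
           (equivalent (subalg (L13_1 \<alpha>)) (subalg (L13_1 \<beta>)) \<longleftrightarrow> \<alpha> = \<beta>))"
proof -
  have dims: "gl.dim (subalg l) = 4" if "l \<in> labels" for l
    using that
    by (cases l rule: labels_cases; simp only: subalg_eqs)
      (blast intro: dim_isomorphic_to isomorphic_alg8_1 isomorphic_alg8_2 isomorphic_toral_nil_M12
        isomorphic_toral_nil_L13 isomorphic_toral_nil_1_0 isomorphic_toral_nil_M14)+
  have subalgebras: "A2_subalgebra (subalg l) \<and> gl.solvable (subalg l)" if "l \<in> labels" for l
    using that
    by (cases l rule: labels_cases; simp only: subalg_eqs)
      (simp_all add: A2_subalgebra_alg8_1 A2_subalgebra_alg8_2 A2_subalgebra_toral_nil solvable_alg8_2
        solvable_borel_algebra[OF toral_nil_subset_borel] solvable_borel_algebra[OF alg8_1_subset_borel])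
  have complete: "\<exists>l\<in>labels. equivalent L (subalg l)"
    if L: "A2_subalgebra L" "gl.solvable L" "gl.dim L = 4" for L
  proof -
    obtain g where g: "det g = 1" "(\<lambda>A. g ** A ** matrix_inv g) ` L \<subseteq> borel_algebra"
      using exists_conjugate_in_borel L(1,2) by blast
    define L' where "L' = (\<lambda>A. g ** A ** matrix_inv g) ` L"
    have "equivalent L L'" unfolding equivalent_def L'_def using g(1) by blast
    moreover have "A2_subalgebra L'" "gl.dim L' = 4"
      using A2_subalgebra_conjugate[OF g(1) L(1)] L(3) by (simp_all add: L'_def)
    then have "equivalent L' alg8_1 \<or> equivalent L' alg8_2 \<or> (\<exists>p q. (p \<noteq> 0 \<or> q \<noteq> 0) \<and> L' = toral_nil p q)"
      using borel_subalgebra_classification g(2) by (simp add: L'_def)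
    then have "\<exists>l\<in>labels. equivalent L' (subalg l)"
      using toral_nil_label subalg_L8_1 subalg_L8_2 equivalent_refl unfolding labels_def
      by (metis Un_iff insertI1 insertI2)
    ultimately show ?thesis using equivalent_trans by blast
  qed
  have inequivalent: "\<not> equivalent alg8_1 (toral_nil p q)" "\<not> equivalent alg8_2 (toral_nil p q)" "\<not> equivalent alg8_2 alg8_1" for p q
    using toral_nil_not_equivalent_alg8_1 toral_nil_not_equivalent_alg8_2 alg8_1_not_equivalent_alg8_2 equivalent_sym by blast+
  \<comment> \<open>Now every nilradical form except \<open>L13_2\<close> has second coordinate 1,
    so proportionality among them means equality of the first coordinates.\<close>
  have L14: "toral_nil 1 (-1) = toral_nil (-1) 1" using toral_nil_scale[of "-1" 1 "-1"] by simp
  have distinct: "\<not> equivalent (subalg l) (subalg l')" if "l \<in> labels" "l' \<in> labels" "l \<noteq> l'" for l l'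
    by (insert that(3), rule labels_cases[OF that(1)]; rule labels_cases[OF that(2)]; simp only: subalg_eqs L14)
      (auto simp: inequivalent toral_nil_not_equivalent_alg8_1 toral_nil_not_equivalent_alg8_2
        alg8_1_not_equivalent_alg8_2 dest: equivalent_toral_nil_imp_proportional)
  have param: "equivalent (subalg (L13_1 \<alpha>)) (subalg (L13_1 \<beta>)) \<longleftrightarrow> \<alpha> = \<beta>" for \<alpha> \<beta>
    unfolding subalg_L13 using equivalent_refl equivalent_toral_nil_imp_proportional[of \<alpha> 1 \<beta> 1] by auto
  show ?thesis
    using dims subalgebras complete distinct
    by (intro conjI allI impI ballI param)
      (auto simp: subalg_eqs isomorphic_alg8_1 isomorphic_alg8_2 isomorphic_toral_nil_M12 isomorphic_toral_nil_L13
        isomorphic_toral_nil_1_0 isomorphic_toral_nil_M14 simp del: subalg.simps)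
qed

end
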